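(* Let $(X,Z)$ be a pair of Banach spaces with property ( * ), let $A\subset X$ be a closed subset of $X$ and let $f:A\to Z$ be a mapping. Then $f$ is Lipschitz and satisfies the mean value condition for a bounded map if and only if there is a $C^1$ smooth and Lipschitz mapping $G:X\to Z$ with $G|_A=f$. Moreover, if $f$ is Lipschitz and satisfies the mean value condition for a bounded map $D:A\to\mathcal{L}(X,Z)$ with $M:=\sup\{\|D(y)\| : y\in A\}<\infty$, then one can obtain a $C^1$ smooth and Lipschitz extension $G:X\to Z$ of $f$ with $\operatorname{Lip}(G)\le(1+C_0)(M+\operatorname{Lip}(f))$, where $C_0$ is the constant given by property ( * ) (which depends only on $X$ and $Z$).
   Context: Banach spaces are real; $C^1$ smooth means continuously Fréchet differentiable. $\mathcal{L}(X,Z)$ is the space of bounded linear maps $X\to Z$ with the operator norm. For a mapping $f:A\to Z$ with $A\subset X$, $\operatorname{Lip}(f)=\sup\{\|f(x)-f(y)\|/\|x-y\| : x,y\in A,\ x\neq y\}$ (equal to $0$ if $A$ has at most one point). Property ( * ): the pair $(X,Z)$ has property ( * ) if there is a constant $C_0\ge 1$, depending only on $X$ and $Z$, such that for every subset $A\subset X$, every Lipschitz mapping $f:A\to Z$ and every $\varepsilon>0$, there is a $C^1$ smooth and Lipschitz mapping $g:X\to Z$ such that $\|f(x)-g(x)\|<\varepsilon$ for all $x\in A$ and $\operatorname{Lip}(g)\le C_0\operatorname{Lip}(f)$. Mean value condition: a mapping $f:A\to Z$, with $A\subset X$ closed, satisfies the mean value condition for the map $D$ if $D:A\to\mathcal{L}(X,Z)$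 is continuous and for every $y\in A$ and every $\varepsilon>0$ there is an open ball $B(y,r)$ in $X$ such that $\|f(z)-f(w)-D(y)(z-w)\|\le\varepsilon\|z-w\|$ for every $z,w\in A\cap B(y,r)$. It satisfies the mean value condition for a bounded map if this holds for some continuous $D$ with $\sup\{\|D(y)\|:y\in A\}<\infty$. *)

theory Defs
  imports "HOL-Analysis.Analysis"
begin

text \<open>
  A mapping \<open>f : A \<rightarrow> Z\<close> with \<open>A \<subseteq> X\<close> is a total function of which only the values on \<open>A\<close>
  are used; \<open>\<L>(X, Z)\<close> is the type of bounded linear functions with the operator norm.
\<close>

definition lipschitz_map :: "'x::real_normed_vector set \<Rightarrow> ('x \<Rightarrow> 'z::real_normed_vector) \<Rightarrow> bool"
  where "lipschitz_map A f \<longleftrightarrow> (\<exists>L. L-lipschitz_on A f)"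

text \<open>
  The supremum of a set of nonnegative reals, taken to be \<open>0\<close> on the empty set, is the
  supremum after inserting \<open>0\<close>. As \<^const>\<open>Sup\<close> on \<^typ>\<open>real\<close> is meaningful only for sets that
  are bounded above, \<open>Lip\<close> is meaningful only for Lipschitz mappings and \<open>sup_opnorm\<close> only for
  bounded maps.
\<close>

definition Lip :: "'x::real_normed_vector set \<Rightarrow> ('x \<Rightarrow> 'z::real_normed_vector) \<Rightarrow> real"
  where "Lip A f =
    Sup (insert 0 {norm (f x - f y) / norm (x - y) | x y. x \<in> A \<and> y \<in> A \<and> x \<noteq> y})"

definition sup_opnorm ::
  "'x::real_normed_vector set \<Rightarrow> ('x \<Rightarrow> 'x \<Rightarrow>\<^sub>L 'z::real_normed_vector) \<Rightarrow> real"
  where "sup_opnorm A D = Sup (insert 0 {norm (D y) | y. y \<in> A})"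

definition C1_smooth :: "('x::real_normed_vector \<Rightarrow> 'z::real_normed_vector) \<Rightarrow> bool"
  where "C1_smooth g \<longleftrightarrow>
    (\<exists>g' :: 'x \<Rightarrow> 'x \<Rightarrow>\<^sub>L 'z.
      (\<forall>x. (g has_derivative blinfun_apply (g' x)) (at x)) \<and> continuous_on UNIV g')"

definition property_star_const ::
  "'x::banach itself \<Rightarrow> 'z::banach itself \<Rightarrow> real \<Rightarrow> bool"
  where "property_star_const X Z C\<^sub>0 \<longleftrightarrow> C\<^sub>0 \<ge> 1 \<and>
    (\<forall>(A :: 'x set) (f :: 'x \<Rightarrow> 'z) \<epsilon>. lipschitz_map A f \<longrightarrow> \<epsilon> > 0 \<longrightarrow>
      (\<exists>g :: 'x \<Rightarrow> 'z. C1_smooth g \<and> lipschitz_map UNIV g \<and>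
        (\<forall>x\<in>A. norm (f x - g x) < \<epsilon>) \<and> Lip UNIV g \<le> C\<^sub>0 * Lip A f))"

definition property_star :: "'x::banach itself \<Rightarrow> 'z::banach itself \<Rightarrow> bool"
  where "property_star X Z \<longleftrightarrow> (\<exists>C\<^sub>0. property_star_const X Z C\<^sub>0)"

definition mean_value_condition ::
  "'x::real_normed_vector set \<Rightarrow> ('x \<Rightarrow> 'z::real_normed_vector) \<Rightarrow> ('x \<Rightarrow> 'x \<Rightarrow>\<^sub>L 'z) \<Rightarrow> bool"
  where "mean_value_condition A f D \<longleftrightarrow> continuous_on A D \<and>
    (\<forall>y\<in>A. \<forall>\<epsilon>>0. \<exists>r>0. \<forall>z \<in> A \<inter> ball y r. \<forall>w \<in> A \<inter> ball y r.
      norm (f z - f w - blinfun_apply (D y) (z - w)) \<le> \<epsilon> * norm (z - w))"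

definition mean_value_condition_bounded ::
  "'x::real_normed_vector set \<Rightarrow> ('x \<Rightarrow> 'z::real_normed_vector) \<Rightarrow> bool"
  where "mean_value_condition_bounded A f \<longleftrightarrow>
    (\<exists>D. mean_value_condition A f D \<and> bdd_above {norm (D y) | y. y \<in> A})"

end

theory Submission
  imports Defs
begin

text \<open>
  If \<open>G\<close> is a \<open>C\<^sup>1\<close> Lipschitz extension of \<open>f\<close>, then its derivative, restricted to \<open>A\<close>, is bounded
  and satisfies the mean value condition by the mean value inequality on small balls
  (\<open>restriction_of_C1_lipschitz\<close>).

  For the converse, the core is an approximation statement (\<open>smooth_approximation\<close>): for every
  \<open>\<epsilon> > 0\<close> there is a \<open>C\<^sup>1\<close> mapping \<open>g\<close> with \<open>norm (g' x) \<le> max M (C L) + \<epsilon>\<close> everywhere, such that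
  on \<open>A\<close> the derivative is \<open>\<epsilon>\<close>-close to \<open>D\<close> and \<open>f - g\<close> is \<open>\<epsilon>\<close>-Lipschitz. The error \<open>f - g\<close>
  then satisfies the hypotheses again with small constants, and summing the approximants of successive
  errors gives the extension (\<open>smooth_extension\<close>).

  To approximate, note that near \<open>y \<in> A\<close> the mapping \<open>f - D y\<close> has a small Lipschitz constant on
  \<open>A\<close>; property (*) replaces it by a \<open>C\<^sup>1\<close> mapping with small derivative, and adding \<open>D y\<close> back
  gives a patch with the right values and derivatives near \<open>y\<close>. The patches, and approximants of
  \<open>f\<close> away from \<open>A\<close>, have to be glued (\<open>gluing\<close>), and three difficulties arise.
  \<^item> There may be uncountably many patches. A decomposition of \<open>A\<close> into countably many
    levels, each a union of uniformly separated sets (\<open>sigma_discrete_decomposition\<close>), reduces the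
    task to one cutoff function per level.
  \<^item> Cutoff functions are real-valued, while property (*) concerns mappings into \<open>Z\<close>. A norming
    functional on \<open>Z\<close> transfers it to real functions (\<open>scalar_star_approximation\<close>).
  \<^item> Off \<open>A\<close> the patches are only known to agree up to a multiple of the distance \<open>d\<close> to \<open>A\<close>, and a
    cutoff around a part of \<open>A\<close> ordinarily has slope of the order of \<open>1 / d\<close>. Stretching the
    transition over many scales, that is, cutting off as a function of \<open>ln d\<close>, reduces the slope to
    \<open>\<eta> / d\<close> with \<open>\<eta>\<close> as small as desired (\<open>logarithmic_cutoff\<close>). Gluing then hardly
    increases the derivative.
\<close>

section \<open>Norming functionals\<close>

text \<open>
  The bound by the norm is part of the notion, so that every member is bounded below by
  \<open>- norm x\<close> and chains have infima.
\<close>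

definition norm_sublinear :: "('z::real_normed_vector \<Rightarrow> real) \<Rightarrow> bool" where
  "norm_sublinear p \<longleftrightarrow> (\<forall>x y. p (x + y) \<le> p x + p y) \<and> (\<forall>t\<ge>0. \<forall>x. p (t *\<^sub>R x) = t * p x)
     \<and> (\<forall>x. p x \<le> norm x)"

lemma norm_sublinearD:
  assumes "norm_sublinear p"
  shows "p (x + y) \<le> p x + p y" "t \<ge> 0 \<Longrightarrow> p (t *\<^sub>R x) = t * p x" "p x \<le> norm x"
    "p 0 = 0" "- norm x \<le> p x" "- p (- x) \<le> p x"
proof -
  show 1: "p (x + y) \<le> p x + p y" "t \<ge> 0 \<Longrightarrow> p (t *\<^sub>R x) = t * p x" "p x \<le> norm x" for x y t
    using assms unfolding norm_sublinear_def by auto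
  show 2: "p 0 = 0" using 1(2)[of 0 0] by simp
  show "- p (- x) \<le> p x" using 1(1)[of x "- x"] 2 by simp
  then show "- norm x \<le> p x" using 1(3)[of "-x"] by simp
qed

text \<open>
  The sublinear functional \<open>q x = inf {p (x + t y) - t p y | t \<ge> 0}\<close> lies below \<open>p\<close> and is at
  most \<open>- p y\<close> at \<open>- y\<close>. This serves twice: it shows that a minimal functional is odd, and it
  prepares, starting from the norm, a functional whose minorants are forced to norm a given vector.
\<close>

lemma sublinear_descend:
  fixes p :: "'z::real_normed_vector \<Rightarrow> real" and y :: 'z
  assumes p: "norm_sublinear p"
  obtains q where "norm_sublinear q" "\<And>x. q x \<le> p x" "q (- y) \<le> - p y"
proof -
  define q where "q = (\<lambda>x. INF t\<in>{0::real..}. p (x + t *\<^sub>R y) - t * p y)"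
  note P = norm_sublinearD[OF p]
  have low: "- norm x \<le> p (x + t *\<^sub>R y) - t * p y" if "t \<ge> 0" for x t
  proof -
    have "t * p y = p ((x + t *\<^sub>R y) + (- x))" using P(2)[OF that] by simp
    also have "\<dots> \<le> p (x + t *\<^sub>R y) + p (- x)" by (rule P(1))
    also have "p (- x) \<le> norm x" using P(3)[of "-x"] by simp
    finally show ?thesis by simp
  qed
  have bdd: "bdd_below ((\<lambda>t. p (x + t *\<^sub>R y) - t * p y) ` {0..})" for x
    using low by (intro bdd_belowI[of _ "- norm x"]) auto
  have le: "q x \<le> p (x + t *\<^sub>R y) - t * p y" if "t \<ge> 0" for x t
    unfolding q_def using that by (intro cINF_lower bdd) auto
  have ge: "c \<le> q x" if "\<And>t. t \<ge> 0 \<Longrightarrow> c \<le> p (x + t *\<^sub>R y) - t * p y" for c x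
    unfolding q_def using that by (intro cINF_greatest) auto
  have qp: "q x \<le> p x" for x using le[of 0 x] by simp
  have qy: "q (- y) \<le> - p y" using le[of 1 "- y"] P(4) by simp
  have add: "q (a + b) \<le> q a + q b" for a b
  proof -
    have "q (a + b) - (p (a + t *\<^sub>R y) - t * p y) \<le> q b" if "t \<ge> 0" for t
    proof (rule ge)
      fix s :: real assume s: "s \<ge> 0"
      have "q (a + b) \<le> p ((a + b) + (t + s) *\<^sub>R y) - (t + s) * p y"
        using that s by (intro le) auto
      also have "(a + b) + (t + s) *\<^sub>R y = (a + t *\<^sub>R y) + (b + s *\<^sub>R y)"
        by (simp add: algebra_simps)
      also have "p \<dots> \<le> p (a + t *\<^sub>R y) + p (b + s *\<^sub>R y)" by (rule P(1))
      finally show "q (a + b) - (p (a + t *\<^sub>R y) - t * p y) \<le> p (b + s *\<^sub>R y) - s * p y"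
        by (simp add: algebra_simps)
    qed
    then have "q (a + b) - q b \<le> q a" by (intro ge) force
    then show ?thesis by simp
  qed
  have q0: "q 0 = 0"
    using qp[of 0] ge[of 0 0] P(2) P(4) by (intro antisym) auto
  have scale_le: "q (r *\<^sub>R a) \<le> r * q a" if r: "r > 0" for r a
  proof -
    have "q (r *\<^sub>R a) / r \<le> q a"
    proof (rule ge)
      fix t :: real assume t: "t \<ge> 0"
      have "q (r *\<^sub>R a) \<le> p (r *\<^sub>R a + (r * t) *\<^sub>R y) - (r * t) * p y"
        using r t by (intro le) auto
      also have "r *\<^sub>R a + (r * t) *\<^sub>R y = r *\<^sub>R (a + t *\<^sub>R y)" by (simp add: algebra_simps)
      also have "p \<dots> = r * p (a + t *\<^sub>R y)" using r by (intro P(2)) auto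
      finally show "q (r *\<^sub>R a) / r \<le> p (a + t *\<^sub>R y) - t * p y"
        using r by (simp add: field_simps)
    qed
    then show ?thesis using r by (simp add: field_simps)
  qed
  have scale: "q (r *\<^sub>R a) = r * q a" if "r \<ge> 0" for r a
  proof (cases "r = 0")
    case False
    then have r: "r > 0" using that by simp
    have "q a \<le> (1 / r) * q (r *\<^sub>R a)" using scale_le[of "1 / r" "r *\<^sub>R a"] r by simp
    then have "r * q a \<le> q (r *\<^sub>R a)" using r by (simp add: field_simps)
    then show ?thesis using scale_le[OF r, of a] by simp
  qed (simp add: q0)
  have "norm_sublinear q"
    unfolding norm_sublinear_def using add scale order_trans[OF qp P(3)] by blast
  then show ?thesis using that qp qy by blast
qed

text \<open>
  A minimal functional coincides with each of its descents, hence \<open>p (- y) \<le> - p y\<close>; an odd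
  sublinear functional is additive because subadditivity at \<open>- x, - y\<close> is the reverse inequality.
\<close>

lemma minimal_sublinear_linear:
  assumes p: "norm_sublinear p" and min: "\<And>q. norm_sublinear q \<Longrightarrow> (\<And>x. q x \<le> p x) \<Longrightarrow> q = p"
  shows "bounded_linear p"
proof -
  note P = norm_sublinearD[OF p]
  have odd: "p (- y) = - p y" for y
  proof -
    obtain q where q: "norm_sublinear q" "\<And>x. q x \<le> p x" "q (- y) \<le> - p y"
      using sublinear_descend[OF p] by blast
    then have "p (- y) \<le> - p y" using min[OF q(1,2)] by simp
    then show ?thesis using P(6)[of y] by simp
  qed
  show ?thesis
  proof (rule bounded_linear_intro[where K = 1])
    fix x y
    have "p (- x + - y) \<le> p (- x) + p (- y)" by (rule P(1))
    moreover have "p (- x + - y) = - p (x + y)" using odd[of "x + y"] by simp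
    ultimately show "p (x + y) = p x + p y" using P(1)[of x y] odd by simp
  next
    fix r x
    show "p (r *\<^sub>R x) = r *\<^sub>R p x"
    proof (cases "r \<ge> 0")
      case False
      then have "p ((- r) *\<^sub>R x) = (- r) * p x" by (intro P(2)) auto
      then show ?thesis using odd[of "r *\<^sub>R x"] by simp
    qed (simp add: P(2))
  next
    fix x show "norm (p x) \<le> norm x * 1" using P(3)[of x] P(5)[of x] by simp
  qed
qed

lemma sublinear_Inf_chain:
  assumes ne: "Q \<noteq> {}" and sub: "\<And>q. q \<in> Q \<Longrightarrow> norm_sublinear q"
    and chain: "\<And>p q. p \<in> Q \<Longrightarrow> q \<in> Q \<Longrightarrow> p \<le> q \<or> q \<le> p"
  shows "norm_sublinear (\<lambda>x. INF q\<in>Q. q x)" (is "norm_sublinear ?i")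
    and "q \<in> Q \<Longrightarrow> (INF q\<in>Q. q x) \<le> q x"
proof -
  have bdd: "bdd_below ((\<lambda>q. q x) ` Q)" for x
    using norm_sublinearD(5)[OF sub] by (intro bdd_belowI[of _ "- norm x"]) auto
  show le: "?i x \<le> q x" if "q \<in> Q" for q x
    using that by (intro cINF_lower bdd) auto
  have ge: "c \<le> ?i x" if "\<And>q. q \<in> Q \<Longrightarrow> c \<le> q x" for c x
    using that ne by (intro cINF_greatest) auto
  have add: "?i (a + b) \<le> ?i a + ?i b" for a b
  proof -
    have pq: "?i (a + b) \<le> p a + q b" if "p \<in> Q" "q \<in> Q" for p q
    proof -
      have "?i (a + b) \<le> p a + p b" "?i (a + b) \<le> q a + q b"
        using order_trans[OF le[OF that(1)] norm_sublinearD(1)[OF sub[OF that(1)]]]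
          order_trans[OF le[OF that(2)] norm_sublinearD(1)[OF sub[OF that(2)]]] by auto
      moreover have "p b \<le> q b \<or> q a \<le> p a" using chain[OF that] by (auto simp: le_fun_def)
      ultimately show ?thesis by auto
    qed
    have "?i (a + b) - p a \<le> ?i b" if "p \<in> Q" for p
    proof (rule ge)
      fix q assume "q \<in> Q"
      from pq[OF that this] show "?i (a + b) - p a \<le> q b" by simp
    qed
    then have "?i (a + b) - ?i b \<le> ?i a" by (intro ge) (simp add: algebra_simps)
    then show ?thesis by simp
  qed
  have scale: "?i (t *\<^sub>R a) = t * ?i a" if t: "t \<ge> 0" for t a
  proof (cases "t = 0")
    case True
    have "(\<lambda>q. q 0) ` Q = (\<lambda>q. 0) ` Q" using norm_sublinearD(4)[OF sub] by (intro image_cong) auto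
    then have "?i 0 = 0" using ne by simp
    then show ?thesis using True by simp
  next
    case False
    then have t: "t > 0" using t by simp
    have "?i (t *\<^sub>R a) / t \<le> ?i a"
    proof (rule ge)
      fix q assume q: "q \<in> Q"
      have "?i (t *\<^sub>R a) \<le> q (t *\<^sub>R a)" by (rule le[OF q])
      then show "?i (t *\<^sub>R a) / t \<le> q a"
        using norm_sublinearD(2)[OF sub[OF q], of t a] t by (simp add: field_simps)
    qed
    moreover have "t * ?i a \<le> ?i (t *\<^sub>R a)"
    proof (rule ge)
      fix q assume q: "q \<in> Q"
      show "t * ?i a \<le> q (t *\<^sub>R a)"
        using le[OF q, of a] norm_sublinearD(2)[OF sub[OF q], of t a] t by simp
    qed
    ultimately show ?thesis using t by (simp add: field_simps)
  qed
  have "?i a \<le> norm a" for a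
    using ne le norm_sublinearD(3)[OF sub] by (meson all_not_in_conv order_trans)
  then show "norm_sublinear ?i" unfolding norm_sublinear_def using add scale by blast
qed

text \<open>
  The Hahn--Banach theorem in the form that is needed. Zorn's lemma gives a minimal functional
  below the descent of the norm in direction \<open>z\<close>; it is linear, and its value at \<open>- z\<close> is at most
  \<open>- norm z\<close>.
\<close>

lemma norming_functional:
  fixes z :: "'z::real_normed_vector"
  obtains l where "bounded_linear l" "l z = norm z" "\<And>x. \<bar>l x\<bar> \<le> norm x"
proof -
  have nrm: "norm_sublinear (norm :: 'z \<Rightarrow> real)"
    unfolding norm_sublinear_def by (auto simp: norm_triangle_ineq)
  obtain p0 :: "'z \<Rightarrow> real" where p0: "norm_sublinear p0" "p0 (- z) \<le> - norm z"
    using sublinear_descend[OF nrm, where y = z] by blast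
  define F where "F = {p. norm_sublinear p \<and> p \<le> p0}"
  let ?P = "\<lambda>p q :: 'z \<Rightarrow> real. q \<le> p"
  have "\<exists>m\<in>F. \<forall>q\<in>F. ?P m q \<longrightarrow> q = m"
  proof (rule predicate_Zorn)
    show "partial_order_on F (relation_of ?P F)"
      by (auto simp: partial_order_on_def preorder_on_def refl_on_def trans_def antisym_def
          relation_of_def intro: order_trans)
  next
    fix Q assume Q: "Q \<in> Chains (relation_of ?P F)"
    then have chain: "p \<le> q \<or> q \<le> p" and sub: "p \<in> F" if "p \<in> Q" "q \<in> Q" for p q
      using that by (auto simp: Chains_def relation_of_def)
    show "\<exists>u\<in>F. \<forall>q\<in>Q. ?P q u"
    proof (cases "Q = {}")
      case True
      then show ?thesis using p0 by (auto simp: F_def)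
    next
      case False
      have sl: "norm_sublinear q" if "q \<in> Q" for q using sub[OF that that] by (simp add: F_def)
      have I: "norm_sublinear (\<lambda>x. INF q\<in>Q. q x)" "q \<in> Q \<Longrightarrow> (INF q\<in>Q. q x) \<le> q x" for q x
        by (intro sublinear_Inf_chain False sl chain; assumption)+
      obtain q where q: "q \<in> Q" using False by blast
      have "(\<lambda>x. INF q\<in>Q. q x) \<le> q" using I(2)[OF q] by (simp add: le_fun_def)
      also have "q \<le> p0" using sub[OF q q] by (simp add: F_def)
      finally have "(\<lambda>x. INF q\<in>Q. q x) \<in> F" using I(1) by (simp add: F_def)
      then show ?thesis using I(2) by (intro bexI[where x = "\<lambda>x. INF q\<in>Q. q x"] ballI le_funI)
    qed
  qed
  then obtain m where m: "m \<in> F" and min: "\<And>q. q \<in> F \<Longrightarrow> q \<le> m \<Longrightarrow> q = m" by blast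
  have ms: "norm_sublinear m" "m \<le> p0" using m by (auto simp: F_def)
  have lin: "bounded_linear m"
  proof (rule minimal_sublinear_linear[OF ms(1)])
    fix q assume "norm_sublinear q" "\<And>x. q x \<le> m x"
    then have "norm_sublinear q" "q \<le> m" by (auto simp: le_fun_def)
    then show "q = m"
      using order_trans[OF _ ms(2)] by (intro min) (simp_all add: F_def)
  qed
  interpret bounded_linear m by (rule lin)
  have "m (- z) \<le> - norm z" using le_funD[OF ms(2), of "- z"] p0(2) by simp
  then have "m z = norm z" using norm_sublinearD(3)[OF ms(1), of z] by (simp add: neg)
  moreover have "\<bar>m x\<bar> \<le> norm x" for x
    using norm_sublinearD(3)[OF ms(1), of x] norm_sublinearD(5)[OF ms(1), of x] by (simp add: abs_le_iff)
  ultimately show ?thesis using that lin by blast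
qed

section \<open>Derivatives and Lipschitz constants\<close>

definition C1_deriv ::
    "('x::real_normed_vector \<Rightarrow> 'z::real_normed_vector) \<Rightarrow> ('x \<Rightarrow> 'x \<Rightarrow>\<^sub>L 'z) \<Rightarrow> bool" where
  "C1_deriv g g' \<longleftrightarrow> (\<forall>x. (g has_derivative blinfun_apply (g' x)) (at x)) \<and> continuous_on UNIV g'"

lemma C1_smooth_iff: "C1_smooth g \<longleftrightarrow> (\<exists>g'. C1_deriv g g')"
  by (simp add: C1_smooth_def C1_deriv_def)

lemma C1_derivD:
  assumes "C1_deriv g g'"
  shows "(g has_derivative blinfun_apply (g' x)) (at x within T)" "continuous_on T g'"
  using assms has_derivative_at_withinI[of g "blinfun_apply (g' x)" x T]
    continuous_on_subset[of UNIV g' T]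
  by (simp_all add: C1_deriv_def)

lemma C1_deriv_const: "C1_deriv (\<lambda>_. c) (\<lambda>_. 0)"
  by (simp add: C1_deriv_def zero_blinfun.rep_eq)

lemma C1_deriv_add:
  assumes "C1_deriv f f'" "C1_deriv g g'"
  shows "C1_deriv (\<lambda>x. f x + g x) (\<lambda>x. f' x + g' x)"
  using assms unfolding C1_deriv_def
  by (auto simp: plus_blinfun.rep_eq intro!: has_derivative_add continuous_on_add)

lemma C1_deriv_diff:
  assumes "C1_deriv f f'" "C1_deriv g g'"
  shows "C1_deriv (\<lambda>x. f x - g x) (\<lambda>x. f' x - g' x)"
  using assms unfolding C1_deriv_def
  by (auto simp: minus_blinfun.rep_eq intro!: has_derivative_diff continuous_on_diff)

lemma C1_deriv_blinfun: "C1_deriv (blinfun_apply T) (\<lambda>_. T)"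
  by (simp add: C1_deriv_def blinfun.bounded_linear_right bounded_linear_imp_has_derivative)

lemma lipschitz_on_of_derivative:
  assumes "convex S" "\<And>x. x \<in> S \<Longrightarrow> (g has_derivative blinfun_apply (g' x)) (at x within S)"
    and "\<And>x. x \<in> S \<Longrightarrow> norm (g' x) \<le> K" "0 \<le> K"
  shows "K-lipschitz_on S g"
  using differentiable_bound[OF assms(1,2)] assms(3,4)
  by (intro lipschitz_onI) (auto simp: dist_norm norm_blinfun.rep_eq)

text \<open>
  The difference quotients at \<open>x\<close> in direction \<open>h\<close> are bounded by \<open>L * norm h\<close>, and they converge
  to \<open>D h\<close>.
\<close>

lemma norm_derivative_le_lipschitz:
  assumes d: "(g has_derivative blinfun_apply D) (at x)" and L: "L-lipschitz_on UNIV g"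
  shows "norm D \<le> L"
proof (rule norm_blinfun_bound)
  show L0: "0 \<le> L" using L by (rule lipschitz_on_nonneg)
  fix h
  show "norm (D h) \<le> L * norm h"
  proof (cases "h = 0")
    case False
    then have h: "norm h > 0" by simp
    have "norm (D h) / norm h \<le> L"
    proof (rule field_le_epsilon)
      fix e :: real assume "e > 0"
      then obtain d where d: "d > 0" and
        D: "\<And>x'. 0 < norm (x' - x) \<Longrightarrow> norm (x' - x) < d \<Longrightarrow>
          norm (g x' - g x - D (x' - x)) / norm (x' - x) < e"
        using d[unfolded has_derivative_at'] by blast
      define t where "t = d / (2 * norm h)"
      have t: "t > 0" using d h by (simp add: t_def)
      define x' where "x' = x + t *\<^sub>R h"
      have nx: "norm (x' - x) = t * norm h" "x' - x = t *\<^sub>R h" using t by (simp_all add: x'_def)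
      have "t * norm h = d / 2" using h by (simp add: t_def)
      then have "norm (g x' - g x - D (x' - x)) < e * norm (x' - x)"
        using D[of x'] d nx t h by (simp add: field_simps)
      moreover have "norm (g x' - g x) \<le> L * norm (x' - x)"
        using lipschitz_onD[OF L, of x' x] by (simp add: dist_norm)
      moreover have "norm (D (x' - x)) \<le> norm (g x' - g x) + norm (g x' - g x - D (x' - x))"
        by (metis norm_triangle_sub norm_minus_commute add.commute)
      ultimately have "norm (D (x' - x)) \<le> (L + e) * (t * norm h)"
        unfolding nx(1) distrib_right by linarith
      moreover have "norm (D (x' - x)) = t * norm (D h)" using nx t by (simp add: blinfun.scaleR_right)
      ultimately have "t * norm (D h) \<le> t * ((L + e) * norm h)" by (simp add: algebra_simps)
      then have "norm (D h) \<le> (L + e) * norm h" using t by simp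
      then show "norm (D h) / norm h \<le> L + e" using h by (simp add: field_simps)
    qed
    then show ?thesis using h by (simp add: field_simps)
  qed (simp add: L0)
qed

lemma Lip_le:
  assumes "L-lipschitz_on A f"
  shows "Lip A f \<le> L"
  unfolding Lip_def
proof (rule cSup_least)
  fix q assume "q \<in> insert 0 {norm (f x - f y) / norm (x - y) |x y. x \<in> A \<and> y \<in> A \<and> x \<noteq> y}"
  then show "q \<le> L"
    using lipschitz_on_nonneg[OF assms] lipschitz_onD[OF assms]
    by (auto simp: dist_norm divide_le_eq)
qed simp

lemma lipschitz_on_Lip:
  assumes "lipschitz_map A f"
  shows "(Lip A f)-lipschitz_on A f"
proof -
  obtain L where L: "L-lipschitz_on A f" using assms by (auto simp: lipschitz_map_def)
  let ?Q = "insert 0 {norm (f x - f y) / norm (x - y) |x y. x \<in> A \<and> y \<in> A \<and> x \<noteq> y}"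
  have bdd: "bdd_above ?Q"
    using lipschitz_on_nonneg[OF L] lipschitz_onD[OF L]
    by (intro bdd_aboveI[of _ L]) (auto simp: dist_norm divide_le_eq)
  show ?thesis
  proof (rule lipschitz_onI)
    fix x y assume xy: "x \<in> A" "y \<in> A"
    show "dist (f x) (f y) \<le> Lip A f * dist x y"
    proof (cases "x = y")
      case False
      then have "norm (f x - f y) / norm (x - y) \<le> Lip A f"
        unfolding Lip_def using xy by (intro cSup_upper bdd) auto
      then show ?thesis using False by (simp add: dist_norm divide_le_eq)
    qed simp
  next
    show "0 \<le> Lip A f" unfolding Lip_def by (intro cSup_upper bdd) simp
  qed
qed

text \<open>
  Property (*) with the Lipschitz constant replaced by any upper bound and with the conclusion
  expressed by the derivative, which is the form in which approximants can be glued.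
\<close>

lemma star_approximation:
  fixes f :: "'x::banach \<Rightarrow> 'z::banach"
  assumes star: "property_star_const TYPE('x) TYPE('z) C"
    and L: "L-lipschitz_on S f" and \<delta>: "\<delta> > 0"
  obtains g g' where "C1_deriv g g'" "\<And>x. norm (g' x) \<le> C * L"
    "\<And>x. x \<in> S \<Longrightarrow> norm (f x - g x) < \<delta>"
proof -
  have "lipschitz_map S f" using L by (auto simp: lipschitz_map_def)
  then obtain g where g: "C1_smooth g" "lipschitz_map UNIV g"
      "\<And>x. x \<in> S \<Longrightarrow> norm (f x - g x) < \<delta>" "Lip UNIV g \<le> C * Lip S f" and C: "C \<ge> 1"
    using star \<delta> unfolding property_star_const_def by blast
  obtain g' where g': "C1_deriv g g'" using g(1) C1_smooth_iff by blast
  have "Lip UNIV g \<le> C * L"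
    using order_trans[OF g(4) mult_left_mono[OF Lip_le[OF L]]] C by simp
  then have "norm (g' x) \<le> C * L" for x
    using order_trans[OF norm_derivative_le_lipschitz[OF C1_derivD(1)[OF g'] lipschitz_on_Lip[OF g(2)]]]
    by blast
  then show ?thesis using that g' g(3) by blast
qed

text \<open>
  Property (*) passes from \<open>Z\<close> to the reals, with the same constant: approximate \<open>u x *\<^sub>R e\<close> for a
  unit vector \<open>e\<close> and apply a functional of norm at most one that maps \<open>e\<close> to one.
\<close>

lemma scalar_star_approximation:
  fixes u :: "'x::banach \<Rightarrow> real" and z :: "'z::banach"
  assumes star: "property_star_const TYPE('x) TYPE('z) C" and z: "z \<noteq> 0"
    and u: "1-lipschitz_on UNIV u" and \<delta>: "\<delta> > 0"
  obtains q q' where "C1_deriv q q'" "\<And>x. norm (q' x) \<le> C" "\<And>x. \<bar>u x - q x\<bar> < \<delta>"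
proof -
  define e where "e = z /\<^sub>R norm z"
  have e: "norm e = 1" using z by (simp add: e_def)
  obtain l where l: "bounded_linear l" "l e = 1" "\<And>x. \<bar>l x\<bar> \<le> norm x"
    using norming_functional[of e] e by metis
  define T where "T = Blinfun l"
  have T: "blinfun_apply T = l" using l(1) by (simp add: T_def bounded_linear_Blinfun_apply)
  have nT: "norm T \<le> 1" by (rule norm_blinfun_bound) (use l(3) in \<open>auto simp: T\<close>)
  have ue: "1-lipschitz_on UNIV (\<lambda>x. u x *\<^sub>R e)"
  proof (rule lipschitz_onI)
    fix x y
    have "dist (u x *\<^sub>R e) (u y *\<^sub>R e) = dist (u x) (u y)"
      by (simp add: dist_norm e flip: scaleR_left_diff_distrib)
    then show "dist (u x *\<^sub>R e) (u y *\<^sub>R e) \<le> 1 * dist x y"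
      using lipschitz_onD[OF u, of x y] by simp
  qed simp
  obtain g g' where g: "C1_deriv g g'" "\<And>x. norm (g' x) \<le> C * 1"
      "\<And>x. x \<in> UNIV \<Longrightarrow> norm (u x *\<^sub>R e - g x) < \<delta>"
    using star_approximation[OF star ue \<delta>] by blast
  have "C1_deriv (\<lambda>x. T (g x)) (\<lambda>x. T o\<^sub>L g' x)"
    unfolding C1_deriv_def
  proof (intro conjI allI)
    fix x show "((\<lambda>x. T (g x)) has_derivative blinfun_apply (T o\<^sub>L g' x)) (at x)"
      using bounded_linear.has_derivative[OF blinfun.bounded_linear_right C1_derivD(1)[OF g(1)]]
      by (simp add: blinfun_compose.rep_eq o_def)
  next
    show "continuous_on UNIV (\<lambda>x. T o\<^sub>L g' x)"
      using C1_derivD(2)[OF g(1)] by (intro continuous_intros)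
  qed
  moreover have "norm (T o\<^sub>L g' x) \<le> C" for x
  proof -
    have "norm (T o\<^sub>L g' x) \<le> norm T * norm (g' x)" by (rule norm_blinfun_compose)
    also have "\<dots> \<le> 1 * norm (g' x)" using nT by (intro mult_right_mono) auto
    finally show ?thesis using g(2)[of x] by simp
  qed
  moreover have "\<bar>u x - T (g x)\<bar> < \<delta>" for x
  proof -
    have "u x - T (g x) = T (u x *\<^sub>R e - g x)"
      by (simp add: blinfun.diff_right blinfun.scaleR_right) (simp add: T l(2))
    then show ?thesis using l(3)[of "u x *\<^sub>R e - g x"] g(3)[of x] by (simp add: T)
  qed
  ultimately show ?thesis using that by blast
qed

section \<open>Discrete decomposition of a set\<close>

text \<open>
  The partition step in the proof of Stone's theorem that metric spaces are paracompact. Well-order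
  the centres and let \<open>S n y\<close> consist of the points that are \<open>(1/2)^n\<close>-deep in the ball of \<open>y\<close>
  but less than \<open>(1/2)^(n+1)\<close>-deep in the ball of every earlier centre. As depth is 1-Lipschitz,
  sets of the same level \<open>n\<close> are uniformly separated, so that one cutoff function per level
  suffices, although the number of balls may be uncountable.
\<close>

lemma sigma_discrete_decomposition:
  fixes A :: "'a::metric_space set" and r :: "'a \<Rightarrow> real"
  assumes r: "\<And>y. y \<in> A \<Longrightarrow> r y > 0"
  obtains S :: "nat \<Rightarrow> 'a \<Rightarrow> 'a set"
  where "\<And>n y. S n y \<subseteq> A" "\<And>n y. S n y \<noteq> {} \<Longrightarrow> y \<in> A" "\<And>x. x \<in> A \<Longrightarrow> \<exists>n y. x \<in> S n y"
    "\<And>n x x' y y'. x \<in> S n y \<Longrightarrow> x' \<in> S n y' \<Longrightarrow> y \<noteq> y' \<Longrightarrow> (1/2) ^ Suc n \<le> dist x x'"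
    "\<And>n x y p. x \<in> S n y \<Longrightarrow> dist x p < (1/2) ^ n \<Longrightarrow> p \<in> ball y (r y)"
proof -
  obtain w :: "'a rel" where "Well_order w \<and> Field w = UNIV"
    using well_ordering[where 'a = 'a] by (rule exE)
  then have w: "Well_order w" "Field w = UNIV" by (rule conjunct1, rule conjunct2)
  have wf: "wf (w - Id)" using w(1) by (simp add: well_order_on_def)
  have tot: "(y, z) \<in> w - Id \<or> (z, y) \<in> w - Id" if "y \<noteq> z" for y z
    using w that by (auto simp: well_order_on_def linear_order_on_def total_on_def)
  define S where "S n y = {x \<in> A. y \<in> A \<and> (1/2) ^ n \<le> r y - dist x y \<and>
      (\<forall>z\<in>A. (z, y) \<in> w - Id \<longrightarrow> r z - dist x z < (1/2) ^ Suc n)}" for n y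
  \<comment> \<open>The point \<open>x\<close> is \<open>(1/2)^n\<close>-deep in the ball of the earlier centre \<open>y\<close>, but \<open>x'\<close> is less than
      half as deep in it.\<close>
  have far: "(1/2) ^ Suc n \<le> dist x x'"
    if "x \<in> S n y" "x' \<in> S n y'" "(y, y') \<in> w - Id" for n x x' y y'
  proof -
    have "(1/2) ^ n \<le> r y - dist x y" using that(1) by (simp add: S_def)
    moreover have "r y - dist x' y < (1/2) ^ Suc n" using that by (auto simp: S_def)
    moreover have "dist x' y \<le> dist x x' + dist x y" by (metis dist_commute dist_triangle)
    ultimately show ?thesis by simp
  qed
  show ?thesis
  proof
    show "S n y \<subseteq> A" for n y by (auto simp: S_def)
    show "y \<in> A" if "S n y \<noteq> {}" for n y using that by (auto simp: S_def)
    show "\<exists>n y. x \<in> S n y" if x: "x \<in> A" for x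
    proof -
      have "x \<in> {y \<in> A. dist x y < r y}" using r[OF x] x by simp
      then obtain y where "y \<in> {y \<in> A. dist x y < r y}"
          and "\<And>z. (z, y) \<in> w - Id \<Longrightarrow> z \<notin> {y \<in> A. dist x y < r y}"
        using wfE_min[OF wf, of x "{y \<in> A. dist x y < r y}"] by blast
      then have y: "y \<in> A" "dist x y < r y"
          and min: "\<And>z. (z, y) \<in> w - Id \<Longrightarrow> z \<in> A \<Longrightarrow> r z \<le> dist x z"
        by (auto simp: not_less)
      obtain n where n: "(1/2 :: real) ^ n < r y - dist x y"
        using real_arch_pow_inv[of "r y - dist x y" "1/2"] y by auto
      have "r z - dist x z < (1/2) ^ Suc n" if "z \<in> A" "(z, y) \<in> w - Id" for z
      proof -
        have "(0::real) < (1/2) ^ Suc n" by simp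
        then show ?thesis using min[OF that(2,1)] by linarith
      qed
      then have "x \<in> S n y" using x y n by (simp add: S_def)
      then show ?thesis by blast
    qed
    show "(1/2) ^ Suc n \<le> dist x x'" if "x \<in> S n y" "x' \<in> S n y'" "y \<noteq> y'" for n x x' y y'
      using far[OF that(1,2)] far[OF that(2,1)] tot[OF that(3)] by (metis dist_commute)
    show "p \<in> ball y (r y)" if "x \<in> S n y" "dist x p < (1/2) ^ n" for n x y p
    proof -
      have "(1/2) ^ n \<le> r y - dist x y" using that(1) by (simp add: S_def)
      moreover have "dist y p \<le> dist x y + dist x p" by (metis dist_commute dist_triangle)
      ultimately show ?thesis using that(2) by simp
    qed
  qed
qed

section \<open>Logarithmic cutoff functions\<close>

text \<open>
  A quadratic spline that falls from one on \<open>u \<le> 0\<close> to zero on \<open>u \<ge> 1\<close>, and its derivative.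
  Written with squared positive parts it is visibly continuously differentiable at its knots
  \<open>0, 1/2, 1\<close>.
\<close>

definition spline :: "real \<Rightarrow> real" where
  "spline u = 2 * (max 0 (1 - u))\<^sup>2 - 4 * (max 0 (1/2 - u))\<^sup>2 + 2 * (max 0 (- u))\<^sup>2"

definition spline' :: "real \<Rightarrow> real" where
  "spline' u = - 4 * max 0 (1 - u) + 8 * max 0 (1/2 - u) - 4 * max 0 (- u)"

lemma DERIV_max0_squared: "((\<lambda>x::real. (max 0 x)\<^sup>2) has_real_derivative 2 * max 0 x) (at x)"
  unfolding has_field_derivative_def
proof (rule has_derivativeI_sandwich[where e = 1 and H = "\<lambda>y. \<bar>y - x\<bar>"])
  show "bounded_linear ((*) (2 * max 0 x))" by (rule bounded_linear_mult_right)
  fix y :: real assume "y \<noteq> x"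
  have "\<bar>(max 0 y)\<^sup>2 - (max 0 x)\<^sup>2 - 2 * max 0 x * (y - x)\<bar> \<le> (y - x)\<^sup>2"
  proof -
    consider "0 \<le> x" "0 \<le> y" | "x \<le> 0" "0 \<le> y" | "0 \<le> x" "y \<le> 0" | "x \<le> 0" "y \<le> 0" by linarith
    then show ?thesis
    proof cases
      case 1
      have "y\<^sup>2 - x\<^sup>2 - 2 * x * (y - x) = (y - x)\<^sup>2" by (simp add: power2_eq_square algebra_simps)
      then show ?thesis using 1 by (simp add: max_def)
    next
      case 2
      have "y\<^sup>2 \<le> (y - x)\<^sup>2" using 2 by (intro power_mono) auto
      then show ?thesis using 2 by (simp add: max_def)
    next
      case 3
      have "- x\<^sup>2 - 2 * x * (y - x) = (y - x)\<^sup>2 - y\<^sup>2" by (simp add: power2_eq_square algebra_simps)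
      moreover have "y\<^sup>2 \<le> (y - x)\<^sup>2"
        using power_mono[of "- y" "x - y" 2] 3 by (simp add: power2_commute)
      ultimately have "\<bar>- x\<^sup>2 - 2 * x * (y - x)\<bar> \<le> (y - x)\<^sup>2" by simp
      then show ?thesis using 3 by (cases "y = 0") (simp_all add: max_def)
    qed (simp add: max_def)
  qed
  then have "\<bar>(max 0 y)\<^sup>2 - (max 0 x)\<^sup>2 - 2 * max 0 x * (y - x)\<bar> \<le> \<bar>y - x\<bar> * \<bar>y - x\<bar>"
    by (simp add: power2_eq_square)
  then show "norm ((max 0 y)\<^sup>2 - (max 0 x)\<^sup>2 - 2 * max 0 x * (y - x)) / norm (y - x) \<le> \<bar>y - x\<bar>"
    using \<open>y \<noteq> x\<close> by (simp add: divide_le_eq)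
next
  show "((\<lambda>y. \<bar>y - x\<bar>) \<longlongrightarrow> 0) (at x)"
    by (rule tendsto_eq_intros | simp)+
qed simp

lemma DERIV_spline: "(spline has_real_derivative spline' u) (at u)"
  unfolding spline_def spline'_def
  by (rule derivative_eq_intros DERIV_chain2[OF DERIV_max0_squared] refl | simp)+

lemma continuous_on_spline': "continuous_on T spline'"
  unfolding spline'_def by (intro continuous_intros)

lemma spline_values:
  shows "u \<le> 0 \<Longrightarrow> spline u = 1" "u \<ge> 1 \<Longrightarrow> spline u = 0" "0 \<le> spline u" "spline u \<le> 1"
    "u \<le> 0 \<Longrightarrow> spline' u = 0" "\<bar>spline' u\<bar> \<le> 2"
proof -
  show *: "spline u = 1" if "u \<le> 0" for u
    using that by (simp add: spline_def max_def power2_eq_square algebra_simps)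
  show **: "spline u = 0" if "u \<ge> 1" for u using that by (simp add: spline_def max_def)
  show "spline' u = 0" if "u \<le> 0" for u using that by (simp add: spline'_def max_def)
  show "\<bar>spline' u\<bar> \<le> 2" by (auto simp: spline'_def max_def abs_le_iff)
  have low: "spline u = 1 - 2 * u\<^sup>2" if "0 \<le> u" "u \<le> 1/2"
    using that by (auto simp: spline_def max_def power2_eq_square algebra_simps)
  have high: "spline u = 2 * (1 - u)\<^sup>2" if "1/2 \<le> u" "u \<le> 1"
    using that by (auto simp: spline_def max_def)
  have sq: "v\<^sup>2 \<le> 1/4" if "0 \<le> v" "v \<le> 1/2" for v :: real
    using power_mono[of v "1/2" 2] that by (simp add: power2_eq_square)
  consider "u \<le> 0" | "0 \<le> u" "u \<le> 1/2" | "1/2 \<le> u" "u \<le> 1" | "1 \<le> u" by linarith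
  then have "0 \<le> spline u \<and> spline u \<le> 1"
  proof cases
    case 2 then show ?thesis using sq[of u] low zero_le_power2[of u] by linarith
  next
    case 3
    have "(1 - u)\<^sup>2 \<le> 1/4" using 3 by (intro sq) auto
    then show ?thesis using high[OF 3] zero_le_power2[of "1 - u"] by linarith
  qed (simp_all add: * **)
  then show "0 \<le> spline u" "spline u \<le> 1" by auto
qed

text \<open>
  A step function of the variable \<open>ln t\<close>: if the transition from one to zero is stretched over the
  interval from \<open>\<rho> exp (- 2 / \<eta>)\<close> to \<open>\<rho>\<close>, the slope at \<open>t\<close> is at most \<open>\<eta> / t\<close>. A linear
  step on \<open>[0, \<rho>]\<close> has slope \<open>1 / \<rho>\<close>, which is not small compared with \<open>1 / t\<close> for \<open>t\<close> near \<open>\<rho>\<close>.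
\<close>

lemma logarithmic_step:
  fixes \<rho> \<eta> :: real
  assumes \<rho>: "\<rho> > 0" and \<eta>: "\<eta> > 0"
  obtains \<tau> \<tau>' :: "real \<Rightarrow> real" and \<rho>' where "0 < \<rho>'" "\<rho>' < \<rho>"
    "\<And>t. (\<tau> has_real_derivative \<tau>' t) (at t)" "continuous_on UNIV \<tau>'"
    "\<And>t. 0 \<le> \<tau> t \<and> \<tau> t \<le> 1" "\<And>t. t \<le> \<rho>' \<Longrightarrow> \<tau> t = 1" "\<And>t. \<rho> \<le> t \<Longrightarrow> \<tau> t = 0"
    "\<And>t. t < \<rho>' \<Longrightarrow> \<tau>' t = 0" "\<And>t. \<bar>\<tau>' t\<bar> * t \<le> \<eta>"
proof -
  define \<rho>' where "\<rho>' = \<rho> * exp (- (2 / \<eta>))"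
  have \<rho>': "0 < \<rho>'" "\<rho>' < \<rho>" using \<rho> \<eta> by (auto simp: \<rho>'_def)
  define u where "u t = \<eta> / 2 * ln (t / \<rho>')" for t
  define \<tau> where "\<tau> t = (if t \<le> 0 then 1 else spline (u t))" for t
  define \<tau>' where "\<tau>' t = (if t \<le> 0 then 0 else spline' (u t) * (\<eta> / 2 / t))" for t
  have u_neg: "u t \<le> 0" if "0 < t" "t \<le> \<rho>'" for t
    using that \<rho>' \<eta> by (simp add: u_def mult_nonneg_nonpos)
  have u_ge1: "u t \<ge> 1" if "\<rho> \<le> t" for t
  proof -
    have "ln (\<rho> / \<rho>') = 2 / \<eta>" using \<rho> by (simp add: \<rho>'_def ln_div ln_mult)
    moreover have "ln (\<rho> / \<rho>') \<le> ln (t / \<rho>')"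
      using that \<rho> \<rho>' by (intro ln_mono divide_right_mono) auto
    ultimately have "\<eta> / 2 * (2 / \<eta>) \<le> u t" using \<eta> unfolding u_def by (intro mult_left_mono) auto
    then show ?thesis using \<eta> by simp
  qed
  have one: "\<tau> t = 1" if "t \<le> \<rho>'" for t
    using that u_neg spline_values(1) by (auto simp: \<tau>_def)
  have zero': "\<tau>' t = 0" if "t < \<rho>'" for t
    using that u_neg[of t] spline_values(5)[of "u t"] by (auto simp: \<tau>'_def)
  have du: "(u has_real_derivative \<eta> / 2 / t) (at t)" if "0 < t" for t
    unfolding u_def using that \<rho>' by (auto intro!: derivative_eq_intros simp: field_simps)
  have der: "(\<tau> has_real_derivative \<tau>' t) (at t)" for t
  proof (cases "t < \<rho>'")
    case True
    have "((\<lambda>_. 1) has_real_derivative 0) (at t)" by simp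
    then show ?thesis unfolding zero'[OF True]
      by (rule has_field_derivative_transform_within_open[of _ _ _ "{..<\<rho>'}"]) (use True one in auto)
  next
    case False
    then have t: "t > 0" using \<rho>' by linarith
    have D: "((\<lambda>t. spline (u t)) has_real_derivative spline' (u t) * (\<eta> / 2 / t)) (at t)"
      by (rule DERIV_chain2[OF DERIV_spline du[OF t]])
    have "\<tau>' t = spline' (u t) * (\<eta> / 2 / t)" using t by (simp add: \<tau>'_def)
    then show ?thesis
      using has_field_derivative_transform_within_open[OF D, of "{0<..}" \<tau>] t
      by (simp add: \<tau>_def)
  qed
  have cont: "continuous_on UNIV \<tau>'"
  proof -
    have "continuous_on {..<\<rho>'} \<tau>'"
      by (rule continuous_on_eq[of _ "\<lambda>_. 0"]) (simp_all add: zero')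
    moreover have "continuous_on {0<..} \<tau>'"
    proof -
      have "continuous_on {0<..} (\<lambda>t. spline' (u t) * (\<eta> / 2 / t))"
        unfolding u_def using \<rho>'
        by (intro continuous_intros continuous_on_compose2[OF continuous_on_spline'[of UNIV]]) auto
      then show ?thesis by (rule continuous_on_eq) (auto simp: \<tau>'_def)
    qed
    moreover have "{..<\<rho>'} \<union> {0<..} = UNIV" using \<rho>'(1) by (auto simp: not_less)
    ultimately show ?thesis using continuous_on_open_Un[of "{..<\<rho>'}" "{0<..}" \<tau>'] by simp
  qed
  have bound: "\<bar>\<tau>' t\<bar> * t \<le> \<eta>" for t
  proof (cases "t \<le> 0")
    case False
    then have "\<bar>\<tau>' t\<bar> * t = \<bar>spline' (u t)\<bar> * (\<eta> / 2)" using \<eta> by (simp add: \<tau>'_def abs_mult)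
    also have "\<dots> \<le> 2 * (\<eta> / 2)" using \<eta> spline_values(6) by (intro mult_right_mono) auto
    finally show ?thesis by simp
  qed (use \<eta> in \<open>simp add: \<tau>'_def\<close>)
  show ?thesis
    by (rule that[OF \<rho>' der cont _ one _ zero' bound])
      (use \<rho> \<rho>' u_ge1 spline_values in \<open>auto simp: \<tau>_def\<close>)
qed

text \<open>
  A logarithmic step of a smoothed distance to \<open>S\<close>. Additive smoothing is enough, because the step
  varies only on an interval bounded away from zero, on which an error below half of its left end
  underestimates distances by a factor of at most two. The slope bound is what makes gluing
  harmless: two mappings that differ at \<open>x\<close> by \<open>O(infdist x A)\<close> can be glued by \<open>\<phi>\<close> at the
  price of \<open>O(\<eta>)\<close> in the derivative.
\<close>

lemma logarithmic_cutoff: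
  fixes S A :: "'x::banach set" and z :: "'z::banach"
  assumes star: "property_star_const TYPE('x) TYPE('z) C" and z: "z \<noteq> 0"
    and SA: "S \<subseteq> A" and \<rho>: "\<rho> > 0" and \<eta>: "\<eta> > 0"
  obtains \<phi> \<phi>' \<rho>' B where "0 < \<rho>'" "C1_deriv \<phi> \<phi>'" "\<And>x. 0 \<le> \<phi> x \<and> \<phi> x \<le> (1::real)"
    "\<And>x s. s \<in> S \<Longrightarrow> dist x s < \<rho>' \<Longrightarrow> \<phi> x = 1" "\<And>x. \<phi> x \<noteq> 0 \<Longrightarrow> \<exists>s\<in>S. dist x s < \<rho>"
    "\<And>x. norm (\<phi>' x) \<le> B" "\<And>x. norm (\<phi>' x) * infdist x A \<le> \<eta>"
proof (cases "S = {}")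
  case True
  show ?thesis
    by (rule that[of 1 "\<lambda>_. 0" "\<lambda>_. 0" 0]) (use True \<eta> in \<open>auto intro: C1_deriv_const\<close>)
next
  case False
  have C: "C \<ge> 1" using star by (simp add: property_star_const_def)
  have "\<rho> / 2 > 0" "\<eta> / (2 * C) > 0" using \<eta> C \<rho> by auto
  then obtain \<tau> \<tau>' :: "real \<Rightarrow> real" and \<rho>1 where \<rho>1: "0 < \<rho>1" "\<rho>1 < \<rho> / 2"
    and \<tau>: "\<And>t. (\<tau> has_real_derivative \<tau>' t) (at t)" "continuous_on UNIV \<tau>'"
    "\<And>t. 0 \<le> \<tau> t \<and> \<tau> t \<le> 1" "\<And>t. t \<le> \<rho>1 \<Longrightarrow> \<tau> t = 1" "\<And>t. \<rho> / 2 \<le> t \<Longrightarrow> \<tau> t = 0"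
    "\<And>t. t < \<rho>1 \<Longrightarrow> \<tau>' t = 0" "\<And>t. \<bar>\<tau>' t\<bar> * t \<le> \<eta> / (2 * C)"
    by (rule logarithmic_step) blast
  have u: "1-lipschitz_on UNIV (\<lambda>x. infdist x S)"
    by (rule lipschitz_onI) (auto simp: dist_real_def infdist_triangle_abs)
  have "\<rho>1 / 2 > 0" using \<rho>1 by simp
  then obtain q q' where q: "C1_deriv q q'" "\<And>x. norm (q' x) \<le> C"
      "\<And>x. \<bar>infdist x S - q x\<bar> < \<rho>1 / 2"
    using scalar_star_approximation[OF star z u] by blast
  define \<phi> where "\<phi> x = \<tau> (q x)" for x
  define \<phi>' where "\<phi>' x = \<tau>' (q x) *\<^sub>R q' x" for x
  have C1: "C1_deriv \<phi> \<phi>'"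
    unfolding C1_deriv_def
  proof (intro conjI allI)
    fix x
    have "(\<tau> has_derivative (*) (\<tau>' (q x))) (at (q x))"
      using \<tau>(1) by (simp add: has_field_derivative_def)
    from has_derivative_compose[OF C1_derivD(1)[OF q(1), of x UNIV] this]
    show "(\<phi> has_derivative blinfun_apply (\<phi>' x)) (at x)"
      by (simp add: \<phi>_def[abs_def] \<phi>'_def scaleR_blinfun.rep_eq)
  next
    have "continuous_on UNIV q"
      using C1_derivD(1)[OF q(1)] by (intro has_derivative_continuous_on)
    then show "continuous_on UNIV \<phi>'"
      unfolding \<phi>'_def using C1_derivD(2)[OF q(1)]
      by (intro continuous_intros continuous_on_compose2[OF \<tau>(2)]) auto
  qed
  have n\<phi>': "norm (\<phi>' x) \<le> \<bar>\<tau>' (q x)\<bar> * C" for x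
    using q(2)[of x] by (simp add: \<phi>'_def mult_left_mono)
  have inf_le: "infdist x A \<le> infdist x S" for x
    by (rule infdist_mono[OF SA False])
  show ?thesis
  proof (rule that[OF _ C1])
    show "0 < \<rho>1 / 2" using \<rho>1 by simp
    show "0 \<le> \<phi> x \<and> \<phi> x \<le> 1" for x using \<tau>(3) by (simp add: \<phi>_def)
    show "\<phi> x = 1" if "s \<in> S" "dist x s < \<rho>1 / 2" for x s
    proof -
      have "q x \<le> \<rho>1" using infdist_le[OF that(1), of x] that(2) q(3)[of x] by linarith
      then show ?thesis using \<tau>(4) by (simp add: \<phi>_def)
    qed
    show "\<exists>s\<in>S. dist x s < \<rho>" if "\<phi> x \<noteq> 0" for x
    proof -
      have "q x < \<rho> / 2" using \<tau>(5)[of "q x"] that by (force simp: \<phi>_def not_le[symmetric])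
      then have "infdist x S < \<rho>" using q(3)[of x] \<rho>1 by linarith
      then have "(INF s\<in>S. dist x s) < \<rho>" using False by (simp add: infdist_def)
      then show ?thesis using cINF_less_iff[OF False bdd_below_image_dist] by blast
    qed
    show "norm (\<phi>' x) \<le> \<eta> / \<rho>1" for x
    proof (cases "q x < \<rho>1")
      case True
      then show ?thesis using \<tau>(6) \<rho>1 \<eta> by (simp add: \<phi>'_def)
    next
      case False
      have "\<bar>\<tau>' (q x)\<bar> * \<rho>1 \<le> \<bar>\<tau>' (q x)\<bar> * q x" using False by (intro mult_left_mono) auto
      also have "\<dots> \<le> \<eta> / (2 * C)" by (rule \<tau>(7))
      finally have "\<bar>\<tau>' (q x)\<bar> * C * \<rho>1 \<le> \<eta> / 2" using C by (simp add: field_simps)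
      then have "\<bar>\<tau>' (q x)\<bar> * C \<le> \<eta> / \<rho>1" using \<rho>1 \<eta> by (simp add: field_simps)
      then show ?thesis using n\<phi>'[of x] by linarith
    qed
    show "norm (\<phi>' x) * infdist x A \<le> \<eta>" for x
    proof (cases "q x < \<rho>1")
      case True
      then show ?thesis using \<tau>(6) \<eta> by (simp add: \<phi>'_def)
    next
      case False
      then have "infdist x A \<le> 2 * q x" using inf_le[of x] q(3)[of x] by linarith
      then have "norm (\<phi>' x) * infdist x A \<le> (\<bar>\<tau>' (q x)\<bar> * C) * (2 * q x)"
        using n\<phi>' C by (intro mult_mono) (auto simp: infdist_nonneg)
      also have "\<dots> = (2 * C) * (\<bar>\<tau>' (q x)\<bar> * q x)" by simp
      also have "\<dots> \<le> (2 * C) * (\<eta> / (2 * C))" using \<tau>(7) C by (intro mult_left_mono) auto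
      also have "\<dots> = \<eta>" using C by simp
      finally show ?thesis .
    qed
  qed
qed

section \<open>Gluing with nested weights\<close>

text \<open>
  \<open>glue a v n k\<close> evaluates at one point the nested combination
  \<open>a\<^sub>k v\<^sub>k + (1 - a\<^sub>k) (a\<^sub>k\<^sub>+\<^sub>1 v\<^sub>k\<^sub>+\<^sub>1 + (1 - a\<^sub>k\<^sub>+\<^sub>1) (\<dots> v\<^sub>k\<^sub>+\<^sub>n))\<close>, where earlier entries take precedence.
  The weight of \<open>v\<^sub>i\<close> is \<open>a\<^sub>i\<close> times the product of the earlier \<open>1 - a\<^sub>j\<close>, and the last entry
  receives the remaining weight. The nested form makes every estimate an induction over a single
  binary gluing.
\<close>

primrec glue :: "(nat \<Rightarrow> real) \<Rightarrow> (nat \<Rightarrow> 'z::real_vector) \<Rightarrow> nat \<Rightarrow> nat \<Rightarrow> 'z" where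
  "glue a v 0 k = v k"
| "glue a v (Suc n) k = a k *\<^sub>R v k + (1 - a k) *\<^sub>R glue a v n (Suc k)"

lemma glue_stable: "a (k + n) = 1 \<Longrightarrow> glue a v (n + m) k = glue a v n k"
proof (induction n arbitrary: k)
  case 0
  then show ?case by (cases m) simp_all
qed simp

lemma glue_const_diff: "glue a (\<lambda>i. c - v i) n k = c - glue a v n k"
proof (induction n arbitrary: k)
  case (Suc n)
  show ?case unfolding glue.simps Suc.IH by (simp add: algebra_simps)
qed simp

lemma norm_convex_le:
  fixes x y :: "'a::real_normed_vector"
  assumes "0 \<le> a" "a \<le> 1" "a > 0 \<Longrightarrow> norm x \<le> r" "a < 1 \<Longrightarrow> norm y \<le> r"
  shows "norm (a *\<^sub>R x + (1 - a) *\<^sub>R y) \<le> r"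
proof -
  have "norm (a *\<^sub>R x + (1 - a) *\<^sub>R y) \<le> a * norm x + (1 - a) * norm y"
    using norm_triangle_ineq[of "a *\<^sub>R x" "(1 - a) *\<^sub>R y"] assms(1,2) by simp
  also have "\<dots> \<le> a * r + (1 - a) * r"
  proof (rule add_mono)
    show "a * norm x \<le> a * r" using assms by (cases "a = 0") auto
    show "(1 - a) * norm y \<le> (1 - a) * r" using assms by (cases "a = 1") auto
  qed
  finally show ?thesis by (simp add: algebra_simps)
qed

lemma norm_glue_le:
  fixes v :: "nat \<Rightarrow> 'z::real_normed_vector"
  assumes a: "\<And>i. 0 \<le> a i \<and> a i \<le> 1" and one: "\<exists>i\<in>{k..k + n}. a i = 1"
    and v: "\<And>i. i \<ge> k \<Longrightarrow> a i > 0 \<Longrightarrow> norm (v i - c) \<le> R"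
  shows "norm (glue a v n k - c) \<le> R"
  using one v
proof (induction n arbitrary: k)
  case (Suc n)
  have eq: "glue a v (Suc n) k - c = a k *\<^sub>R (v k - c) + (1 - a k) *\<^sub>R (glue a v n (Suc k) - c)"
    by (simp add: algebra_simps)
  have "norm (glue a v n (Suc k) - c) \<le> R" if "a k < 1"
  proof (rule Suc.IH)
    obtain i where "k \<le> i" "i \<le> k + Suc n" "a i = 1" using Suc.prems(1) by auto
    then show "\<exists>i\<in>{Suc k..Suc k + n}. a i = 1"
      using that by (intro bexI[of _ i]) (auto simp: Suc_le_eq le_less)
  qed (use Suc.prems(2) in auto)
  then show ?case unfolding eq using a Suc.prems(2) by (intro norm_convex_le) auto
qed simp

text \<open>
  For \<open>a \<le> b\<close> the difference is the combination \<open>a (x - y) + (1 - b) (x' - y')\<close>, whose weights sum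
  to at most one, plus \<open>(b - a) (x' - y)\<close>. Every bound is conditional on a nonzero weight,
  because a mapping with weight zero may be meaningless at the point in question.
\<close>

lemma norm_convex_diff_le:
  fixes x y x' y' :: "'z::real_normed_vector"
  assumes a: "0 \<le> a" "a \<le> 1" and b: "0 \<le> b" "b \<le> 1"
    and T: "a > 0 \<Longrightarrow> norm x \<le> T" "b > 0 \<Longrightarrow> norm y \<le> T" "a < 1 \<Longrightarrow> norm x' \<le> T" "b < 1 \<Longrightarrow> norm y' \<le> T"
    and E: "a > 0 \<Longrightarrow> b > 0 \<Longrightarrow> norm (x - y) \<le> E" "a < 1 \<Longrightarrow> b < 1 \<Longrightarrow> norm (x' - y') \<le> E" "0 \<le> E"
  shows "norm (a *\<^sub>R x + (1 - a) *\<^sub>R x' - (b *\<^sub>R y + (1 - b) *\<^sub>R y')) \<le> E + 2 * T * \<bar>a - b\<bar>"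
proof -
  have main: "norm (a *\<^sub>R x + (1 - a) *\<^sub>R x' - (b *\<^sub>R y + (1 - b) *\<^sub>R y')) \<le> E + 2 * T * (b - a)"
    if ab: "a \<le> b" and a: "0 \<le> a" and b: "b \<le> 1"
      and T: "b > 0 \<Longrightarrow> norm y \<le> T" "a < 1 \<Longrightarrow> norm x' \<le> T"
      and E: "a > 0 \<Longrightarrow> norm (x - y) \<le> E" "b < 1 \<Longrightarrow> norm (x' - y') \<le> E"
    for a b :: real and x y x' y' :: 'z
  proof -
    have "a *\<^sub>R x + (1 - a) *\<^sub>R x' - (b *\<^sub>R y + (1 - b) *\<^sub>R y') =
        (a *\<^sub>R (x - y) + (1 - b) *\<^sub>R (x' - y')) + ((b - a) *\<^sub>R x' - (b - a) *\<^sub>R y)"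
      by (simp add: algebra_simps)
    also have "norm \<dots> \<le> norm (a *\<^sub>R (x - y) + (1 - b) *\<^sub>R (x' - y')) + norm ((b - a) *\<^sub>R x' - (b - a) *\<^sub>R y)"
      by (rule norm_triangle_ineq)
    also have "norm (a *\<^sub>R (x - y) + (1 - b) *\<^sub>R (x' - y')) \<le> a * norm (x - y) + (1 - b) * norm (x' - y')"
      using norm_triangle_ineq[of "a *\<^sub>R (x - y)" "(1 - b) *\<^sub>R (x' - y')"] a b by simp
    also have "a * norm (x - y) \<le> a * E" using a E(1) by (cases "a = 0") auto
    also have "(1 - b) * norm (x' - y') \<le> (1 - b) * E" using b E(2) by (cases "b = 1") auto
    also have "norm ((b - a) *\<^sub>R x' - (b - a) *\<^sub>R y) \<le> (b - a) * norm x' + (b - a) * norm y"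
      using norm_triangle_ineq4[of "(b - a) *\<^sub>R x'" "(b - a) *\<^sub>R y"] ab by simp
    also have "(b - a) * norm x' \<le> (b - a) * T" using ab a b T(2) by (cases "a = b") auto
    also have "(b - a) * norm y \<le> (b - a) * T" using ab a b T(1) by (cases "a = b") auto
    finally have "norm (a *\<^sub>R x + (1 - a) *\<^sub>R x' - (b *\<^sub>R y + (1 - b) *\<^sub>R y'))
        \<le> E - (b - a) * E + 2 * T * (b - a)" by (simp add: algebra_simps)
    moreover have "0 \<le> (b - a) * E" using ab assms(11) by simp
    ultimately show ?thesis by linarith
  qed
  show ?thesis
  proof (cases "a \<le> b")
    case True
    then show ?thesis using main[of a b y x' x y'] assms by simp
  next
    case False
    have "norm (b *\<^sub>R y + (1 - b) *\<^sub>R y' - (a *\<^sub>R x + (1 - a) *\<^sub>R x')) \<le> E + 2 * T * (a - b)"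
      using False assms by (intro main) (auto simp: norm_minus_commute)
    then show ?thesis using False by (simp add: norm_minus_commute)
  qed
qed

text \<open>
  Here \<open>v\<close> and \<open>w\<close> are the approximation errors at two points of distance \<open>\<delta>\<close>. Each binary gluing
  adds to the common Lipschitz constant \<open>\<beta>\<close> of the errors only the variation of the weight times the
  size of the errors.
\<close>

lemma norm_glue_diff_le:
  fixes v w :: "nat \<Rightarrow> 'z::real_normed_vector"
  assumes a: "\<And>i. 0 \<le> a i \<and> a i \<le> 1" and b: "\<And>i. 0 \<le> b i \<and> b i \<le> 1"
    and one: "\<exists>i\<in>{k..k + n}. a i = 1" "\<exists>i\<in>{k..k + n}. b i = 1"
    and ab: "\<And>i. \<bar>a i - b i\<bar> \<le> B i * \<delta>"
    and v: "\<And>i. a i > 0 \<Longrightarrow> norm (v i) \<le> t i" and w: "\<And>i. b i > 0 \<Longrightarrow> norm (w i) \<le> t i"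
    and vw: "\<And>i. a i > 0 \<Longrightarrow> b i > 0 \<Longrightarrow> norm (v i - w i) \<le> \<beta> * \<delta>"
    and t: "antimono t" "\<And>i. 0 \<le> t i" and pos: "0 \<le> \<beta>" "0 \<le> \<delta>"
  shows "norm (glue a v n k - glue b w n k) \<le> (\<beta> + (\<Sum>i\<in>{k..<k + n}. 2 * (t i * B i))) * \<delta>"
  using one
proof (induction n arbitrary: k)
  case 0
  then show ?case using vw by auto
next
  case (Suc n)
  let ?\<Sigma> = "\<lambda>k n. \<Sum>i\<in>{k..<k + n}. 2 * (t i * B i)"
  have later: "\<exists>i\<in>{Suc k..Suc k + n}. c i = 1" if c: "c k < 1" "\<exists>i\<in>{k..k + Suc n}. c i = 1" for c :: "nat \<Rightarrow> real"
  proof -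
    obtain i where "k \<le> i" "i \<le> k + Suc n" "c i = 1" using c(2) by auto
    then show ?thesis using c(1) by (intro bexI[of _ i]) (auto simp: Suc_le_eq le_less)
  qed
  have Bd: "0 \<le> B i * \<delta>" for i using order_trans[OF abs_ge_zero ab] .
  then have tB: "0 \<le> t i * B i * \<delta>" for i using t(2)[of i] by (simp add: mult.assoc)
  have S0: "0 \<le> ?\<Sigma> k' n' * \<delta>" for k' n'
    unfolding sum_distrib_right using tB by (intro sum_nonneg) (simp add: mult.assoc)
  have tle: "t i \<le> t k" if "Suc k \<le> i" for i using t(1) that by (auto simp: antimono_def)
  have E: "\<beta> * \<delta> \<le> (\<beta> + ?\<Sigma> (Suc k) n) * \<delta>" using S0[of "Suc k" n] by (simp add: distrib_right)
  have "norm (glue a v (Suc n) k - glue b w (Suc n) k)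
      \<le> (\<beta> + ?\<Sigma> (Suc k) n) * \<delta> + 2 * t k * \<bar>a k - b k\<bar>"
    unfolding glue.simps
  proof (rule norm_convex_diff_le)
    show "norm (glue a v n (Suc k)) \<le> t k" if "a k < 1"
      using norm_glue_le[OF a later[OF that Suc.prems(1)], of v 0 "t k"] v tle by (auto intro: order_trans)
    show "norm (glue b w n (Suc k)) \<le> t k" if "b k < 1"
      using norm_glue_le[OF b later[OF that Suc.prems(2)], of w 0 "t k"] w tle by (auto intro: order_trans)
    show "norm (v k - w k) \<le> (\<beta> + ?\<Sigma> (Suc k) n) * \<delta>" if "a k > 0" "b k > 0"
      using vw[OF that] E by linarith
    show "norm (glue a v n (Suc k) - glue b w n (Suc k)) \<le> (\<beta> + ?\<Sigma> (Suc k) n) * \<delta>"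
      if "a k < 1" "b k < 1"
      using Suc.IH[OF later[OF that(1) Suc.prems(1)] later[OF that(2) Suc.prems(2)]] .
    show "0 \<le> (\<beta> + ?\<Sigma> (Suc k) n) * \<delta>" using E pos by (meson mult_nonneg_nonneg order_trans)
  qed (use a b v w in auto)
  also have "2 * t k * \<bar>a k - b k\<bar> \<le> 2 * t k * (B k * \<delta>)"
    using ab t(2) by (intro mult_left_mono) auto
  also have "?\<Sigma> (Suc k) n = ?\<Sigma> k (Suc n) - 2 * (t k * B k)"
    using sum.atLeast_Suc_lessThan[of k "k + Suc n" "\<lambda>i. 2 * (t i * B i)"] by simp
  also have "(\<beta> + (?\<Sigma> k (Suc n) - 2 * (t k * B k))) * \<delta> + 2 * t k * (B k * \<delta>) = (\<beta> + ?\<Sigma> k (Suc n)) * \<delta>"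
    by (simp only: algebra_simps)
  finally show ?case by simp
qed

text \<open>
  The derivative of \<open>\<lambda>x. glue (\<lambda>i. \<omega> i x) (\<lambda>i. h i x) n k\<close> by the product rule. The terms with
  \<open>\<omega>' k x\<close> are collected into one difference, which is small when the glued mappings nearly agree.
\<close>

primrec glue' :: "(nat \<Rightarrow> 'x::real_normed_vector \<Rightarrow> real) \<Rightarrow> (nat \<Rightarrow> 'x \<Rightarrow> 'x \<Rightarrow>\<^sub>L real) \<Rightarrow>
    (nat \<Rightarrow> 'x \<Rightarrow> 'z::real_normed_vector) \<Rightarrow> (nat \<Rightarrow> 'x \<Rightarrow> 'x \<Rightarrow>\<^sub>L 'z) \<Rightarrow> nat \<Rightarrow> nat \<Rightarrow> 'x \<Rightarrow> 'x \<Rightarrow>\<^sub>L 'z"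
  where
  "glue' \<omega> \<omega>' h h' 0 k x = h' k x"
| "glue' \<omega> \<omega>' h h' (Suc n) k x = (\<omega> k x *\<^sub>R h' k x + (1 - \<omega> k x) *\<^sub>R glue' \<omega> \<omega>' h h' n (Suc k) x) +
    (blinfun_scaleR_left (h k x - glue (\<lambda>i. \<omega> i x) (\<lambda>i. h i x) n (Suc k)) o\<^sub>L \<omega>' k x)"

lemma norm_blinfun_scaleR_left_compose:
  "norm (blinfun_scaleR_left z o\<^sub>L T) \<le> norm z * norm T"
proof (rule norm_blinfun_bound)
  fix x
  have "norm (T x) * norm z \<le> (norm T * norm x) * norm z"
    by (intro mult_right_mono norm_blinfun) auto
  then show "norm ((blinfun_scaleR_left z o\<^sub>L T) x) \<le> norm z * norm T * norm x"
    by (simp add: mult_ac)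
qed simp

text \<open>
  The first part of the derivative is a convex combination of derivatives close to \<open>Q\<close>. In the
  second part, both \<open>h k x\<close> and the rest of the gluing are within \<open>R k\<close> of \<open>c\<close>, the latter because
  it is a convex combination of later entries and \<open>R\<close> decreases.
\<close>

lemma norm_glue'_diff_le:
  assumes \<omega>: "\<And>i. 0 \<le> \<omega> i x \<and> \<omega> i x \<le> 1" and one: "\<omega> (k + n) x = 1"
    and W: "\<And>i. x \<notin> W i \<Longrightarrow> \<omega> i x = 0 \<and> \<omega>' i x = 0"
    and h': "\<And>i. x \<in> W i \<Longrightarrow> norm (h' i x - Q) \<le> K"
    and h: "\<And>i. x \<in> W i \<Longrightarrow> norm (h i x - c) \<le> R i"
    and R: "antimono R" "\<And>i. 0 \<le> R i"
  shows "norm (glue' \<omega> \<omega>' h h' n k x - Q) \<le> K + (\<Sum>i\<in>{k..<k + n}. 2 * (R i * norm (\<omega>' i x)))"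
  using one
proof (induction n arbitrary: k)
  case 0
  then have "x \<in> W k" using W[of k] by auto
  then show ?case using h' by simp
next
  case (Suc n)
  define G where "G = glue (\<lambda>i. \<omega> i x) (\<lambda>i. h i x) n (Suc k)"
  define G' where "G' = glue' \<omega> \<omega>' h h' n (Suc k) x"
  let ?\<Sigma> = "\<lambda>k n. \<Sum>i\<in>{k..<k + n}. 2 * (R i * norm (\<omega>' i x))"
  have S0: "0 \<le> ?\<Sigma> k' n'" for k' n' using R(2) by (intro sum_nonneg) simp
  have IH: "norm (G' - Q) \<le> K + ?\<Sigma> (Suc k) n" unfolding G'_def using Suc.prems by (intro Suc.IH) simp
  have Rle: "R i \<le> R k" if "Suc k \<le> i" for i using R(1) that by (auto simp: antimono_def)
  have "norm (G - c) \<le> R k"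
    unfolding G_def
  proof (rule norm_glue_le)
    show "\<exists>i\<in>{Suc k..Suc k + n}. \<omega> i x = 1" using Suc.prems by auto
    show "norm (h i x - c) \<le> R k" if "Suc k \<le> i" "\<omega> i x > 0" for i
    proof -
      have "x \<in> W i" using W[of i] that(2) by auto
      then show ?thesis using order_trans[OF h Rle[OF that(1)]] by blast
    qed
  qed (use \<omega> in auto)
  have t2: "norm (blinfun_scaleR_left (h k x - G) o\<^sub>L \<omega>' k x) \<le> 2 * (R k * norm (\<omega>' k x))"
  proof (cases "x \<in> W k")
    case True
    have "norm (h k x - G) \<le> norm (h k x - c) + norm (G - c)"
      using norm_triangle_ineq4[of "h k x - c" "G - c"] by simp
    then have "norm (h k x - G) \<le> 2 * R k" using h[OF True] \<open>norm (G - c) \<le> R k\<close> by linarith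
    then have "norm (h k x - G) * norm (\<omega>' k x) \<le> (2 * R k) * norm (\<omega>' k x)"
      by (intro mult_right_mono) auto
    then show ?thesis using norm_blinfun_scaleR_left_compose[of "h k x - G" "\<omega>' k x"] by (simp add: mult.assoc)
  qed (use W in simp)
  have "glue' \<omega> \<omega>' h h' (Suc n) k x - Q = (\<omega> k x *\<^sub>R (h' k x - Q) + (1 - \<omega> k x) *\<^sub>R (G' - Q)) +
      (blinfun_scaleR_left (h k x - G) o\<^sub>L \<omega>' k x)"
    by (simp add: G_def G'_def algebra_simps)
  also have "norm \<dots> \<le> norm (\<omega> k x *\<^sub>R (h' k x - Q) + (1 - \<omega> k x) *\<^sub>R (G' - Q)) +
      norm (blinfun_scaleR_left (h k x - G) o\<^sub>L \<omega>' k x)" by (rule norm_triangle_ineq)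
  also have "norm (\<omega> k x *\<^sub>R (h' k x - Q) + (1 - \<omega> k x) *\<^sub>R (G' - Q)) \<le> K + ?\<Sigma> (Suc k) n"
  proof (rule norm_convex_le)
    show "norm (h' k x - Q) \<le> K + ?\<Sigma> (Suc k) n" if "\<omega> k x > 0"
    proof -
      have "x \<in> W k" using that W[of k] by auto
      then show ?thesis using h'[of k] S0[of "Suc k" n] by linarith
    qed
  qed (use \<omega> IH in auto)
  finally have "norm (glue' \<omega> \<omega>' h h' (Suc n) k x - Q) \<le> K + (2 * (R k * norm (\<omega>' k x)) + ?\<Sigma> (Suc k) n)"
    using t2 by linarith
  moreover have "?\<Sigma> k (Suc n) = 2 * (R k * norm (\<omega>' k x)) + ?\<Sigma> (Suc k) n"
    using sum.atLeast_Suc_lessThan[of k "k + Suc n" "\<lambda>i. 2 * (R i * norm (\<omega>' i x))"] by simp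
  ultimately show ?case by simp
qed

lemma C1_deriv_locally_zero:
  assumes "C1_deriv g g'" "\<forall>\<^sub>F p in nhds x. g p = 0"
  shows "g' x = 0"
proof -
  obtain U where U: "open U" "x \<in> U" "\<And>p. p \<in> U \<Longrightarrow> g p = 0"
    using assms(2) by (auto simp: eventually_nhds)
  have "((\<lambda>_. 0) has_derivative blinfun_apply (g' x)) (at x)"
    by (rule has_derivative_transform_within_open[OF C1_derivD(1)[OF assms(1)] U(1,2)]) (simp add: U(3))
  then have "blinfun_apply (g' x) = (\<lambda>_. 0)" by (rule has_derivative_unique) simp
  then show ?thesis by (intro blinfun_eqI) (simp add: zero_blinfun.rep_eq)
qed

text \<open>
  The entry \<open>h i\<close> is differentiable only on \<open>W i\<close>. At other points its weight vanishes
  in a neighbourhood, so the gluing and its formal derivative locally agree with those that start at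
  the next index.
\<close>

lemma glue_has_derivative:
  fixes h :: "nat \<Rightarrow> 'x::real_normed_vector \<Rightarrow> 'z::real_normed_vector"
  assumes \<omega>: "\<And>i. C1_deriv (\<omega> i) (\<omega>' i)" and W: "\<And>i. open (W i)"
    and off: "\<And>i x. x \<notin> W i \<Longrightarrow> \<forall>\<^sub>F p in nhds x. \<omega> i p = 0"
    and h: "\<And>i x. x \<in> W i \<Longrightarrow> (h i has_derivative blinfun_apply (h' i x)) (at x)"
    and h': "\<And>i. continuous_on (W i) (h' i)"
    and U: "x \<in> W (k + n)"
  shows "((\<lambda>x. glue (\<lambda>i. \<omega> i x) (\<lambda>i. h i x) n k) has_derivative blinfun_apply (glue' \<omega> \<omega>' h h' n k x)) (at x)"
    (is "?der n k") and "isCont (glue' \<omega> \<omega>' h h' n k) x" (is "?cont n k")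
proof -
  have "?der n k \<and> ?cont n k" using U
  proof (induction n arbitrary: k)
    case 0
    then show ?case using h h' W by (auto simp: continuous_on_eq_continuous_at)
  next
    case (Suc n)
    let ?G = "\<lambda>x. glue (\<lambda>i. \<omega> i x) (\<lambda>i. h i x) n (Suc k)"
    let ?G' = "glue' \<omega> \<omega>' h h' n (Suc k)"
    have IH: "(?G has_derivative blinfun_apply (?G' x)) (at x)" "isCont ?G' x"
      using Suc.IH[of "Suc k"] Suc.prems by auto
    have Gc: "isCont ?G x" using IH(1) by (rule has_derivative_continuous)
    show ?case
    proof (cases "x \<in> W k")
      case True
      have "((\<lambda>x. \<omega> k x *\<^sub>R h k x + (1 - \<omega> k x) *\<^sub>R ?G x) has_derivative
          (\<lambda>v. (\<omega> k x *\<^sub>R h' k x v + \<omega>' k x v *\<^sub>R h k x) +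
            ((1 - \<omega> k x) *\<^sub>R ?G' x v + (0 - \<omega>' k x v) *\<^sub>R ?G x))) (at x)"
        by (intro has_derivative_add has_derivative_scaleR has_derivative_diff has_derivative_const
            C1_derivD(1)[OF \<omega>] h[OF True] IH(1))
      moreover have "blinfun_apply (glue' \<omega> \<omega>' h h' (Suc n) k x) =
          (\<lambda>v. (\<omega> k x *\<^sub>R h' k x v + \<omega>' k x v *\<^sub>R h k x) +
            ((1 - \<omega> k x) *\<^sub>R ?G' x v + (0 - \<omega>' k x v) *\<^sub>R ?G x))"
        by (rule ext) (simp add: blinfun.add_left blinfun.scaleR_left scaleR_diff_right)
      ultimately have "((\<lambda>x. \<omega> k x *\<^sub>R h k x + (1 - \<omega> k x) *\<^sub>R ?G x) has_derivative
          blinfun_apply (glue' \<omega> \<omega>' h h' (Suc n) k x)) (at x)" by simp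
      moreover have "isCont (h' k) x" using h' W True by (auto simp: continuous_on_eq_continuous_at)
      moreover have "isCont (\<omega> k) x" using C1_derivD(1)[OF \<omega>] by (rule has_derivative_continuous)
      moreover have "isCont (h k) x" using h[OF True] by (rule has_derivative_continuous)
      moreover have "isCont (\<omega>' k) x"
        using C1_derivD(2)[OF \<omega>, of UNIV] by (simp add: continuous_on_eq_continuous_at)
      ultimately show ?thesis
        using IH(2) Gc by (auto intro!: continuous_intros bounded_linear.isCont[OF bounded_linear_blinfun_scaleR_left])
    next
      case False
      have ev: "\<forall>\<^sub>F p in nhds x. \<omega> k p = 0 \<and> \<omega>' k p = 0"
        using eventually_eventually[THEN iffD2, OF off[OF False]] off[OF False]
        by eventually_elim (simp add: C1_deriv_locally_zero[OF \<omega>])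
      then obtain V where V: "open V" "x \<in> V" "\<And>p. p \<in> V \<Longrightarrow> \<omega> k p = 0 \<and> \<omega>' k p = 0"
        by (auto simp: eventually_nhds)
      have "?der (Suc n) k"
        using has_derivative_transform_within_open[OF IH(1) V(1,2), of "\<lambda>x. glue (\<lambda>i. \<omega> i x) (\<lambda>i. h i x) (Suc n) k"] V
        by simp
      moreover have "?cont (Suc n) k"
      proof -
        have "\<forall>\<^sub>F p in nhds x. glue' \<omega> \<omega>' h h' (Suc n) k p = ?G' p"
          using ev by eventually_elim simp
        then show ?thesis using isCont_cong IH(2) by blast
      qed
      ultimately show ?thesis ..
    qed
  qed
  then show "?der n k" "?cont n k" by auto
qed

lemma sum_half_powers_le: "(\<Sum>i\<in>{0..<n}. c * (1/2 :: real) ^ i) \<le> 2 * c" if "0 \<le> c"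
proof -
  have "(\<Sum>i\<in>{0..<n}. (1/2 :: real) ^ i) \<le> 2"
    by (simp add: atLeast0LessThan sum_gp_strict)
  then have "c * (\<Sum>i\<in>{0..<n}. (1/2 :: real) ^ i) \<le> c * 2" using that by (rule mult_left_mono)
  then show ?thesis by (simp add: sum_distrib_left)
qed

text \<open>
  Infinitely many mappings are glued along \<open>A\<close>, each defined near its own part of \<open>A\<close> or away
  from \<open>A\<close>. Near every point some weight is one, so the gluing is locally one of its finite stages
  and inherits their smoothness.

  The derivative of a stage differs from a convex combination of the \<open>h' k x\<close> by terms
  \<open>\<omega>' k x\<close> times a difference of values. Comparing values with \<open>f a\<close> at a nearly closest point
  \<open>a \<in> A\<close> bounds this difference by \<open>2 (t k + 2 K infdist x A)\<close>. The part \<open>t k\<close> is compensated by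
  choosing \<open>t k\<close> small compared with \<open>1 / B k\<close>, the part with \<open>infdist x A\<close> by the logarithmic
  slope of the cutoff.
\<close>

lemma gluing:
  fixes A :: "'x::real_normed_vector set" and f :: "'x \<Rightarrow> 'z::real_normed_vector"
  assumes A: "closed A" "A \<noteq> {}"
    and \<omega>: "\<And>k. C1_deriv (\<omega> k) (\<omega>' k)" "\<And>k x. 0 \<le> \<omega> k x \<and> \<omega> k x \<le> (1::real)"
    and B: "\<And>k x. norm (\<omega>' k x) \<le> B k"
    and \<eta>: "\<And>k x. norm (\<omega>' k x) * infdist x A \<le> \<eta> k"
    and W: "\<And>k. open (W k)" "\<And>k x. x \<notin> W k \<Longrightarrow> \<forall>\<^sub>F p in nhds x. \<omega> k p = 0"
    and cover: "\<And>x. \<exists>k. \<forall>\<^sub>F p in nhds x. \<omega> k p = 1"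
    and h: "\<And>k x. x \<in> W k \<Longrightarrow> (h k has_derivative blinfun_apply (h' k x)) (at x)"
    and h': "\<And>k. continuous_on (W k) (h' k)" "\<And>k x. x \<in> W k \<Longrightarrow> norm (h' k x) \<le> K"
    and near: "\<And>k x a. x \<in> W k \<Longrightarrow> a \<in> A \<Longrightarrow> dist x a \<le> 2 * infdist x A \<Longrightarrow>
      norm (h k x - f a) \<le> t k + 2 * K * infdist x A"
    and on_A: "\<And>k a. a \<in> A \<Longrightarrow> a \<in> W k \<Longrightarrow> norm (h' k a - D a) \<le> \<beta>"
      "\<And>k z w. z \<in> A \<Longrightarrow> z \<in> W k \<Longrightarrow> w \<in> A \<Longrightarrow> w \<in> W k \<Longrightarrow>
        norm ((f z - h k z) - (f w - h k w)) \<le> \<beta> * norm (z - w)"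
    and t: "antimono t" "\<And>k. 0 \<le> t k" "\<And>k. t k * B k \<le> s * (1/2) ^ k"
    and \<eta>K: "\<And>k. \<eta> k * K \<le> s * (1/2) ^ k"
    and pos: "0 \<le> K" "0 \<le> \<beta>" "0 \<le> s"
  obtains g g' where "C1_deriv g g'" "\<And>x. norm (g' x) \<le> K + 12 * s"
    "\<And>a. a \<in> A \<Longrightarrow> norm (g' a - D a) \<le> \<beta> + 4 * s"
    "(\<beta> + 4 * s)-lipschitz_on A (\<lambda>x. f x - g x)"
proof -
  let ?G = "\<lambda>n x. glue (\<lambda>i. \<omega> i x) (\<lambda>i. h i x) n 0"
  let ?G' = "\<lambda>n. glue' \<omega> \<omega>' h h' n 0"
  \<comment> \<open>Later stages do not change the value once a weight is one, so any such index gives the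
      same value.\<close>
  define N where "N x = (LEAST k. \<omega> k x = 1)" for x
  define g where "g x = ?G (N x) x" for x
  have g_eq: "g x = ?G j x" if "\<omega> j x = 1" for j x
  proof -
    have "\<omega> (N x) x = 1" "N x \<le> j" unfolding N_def using that by (auto intro: LeastI Least_le)
    then show ?thesis
      using glue_stable[of "\<lambda>i. \<omega> i x" 0 "N x" "\<lambda>i. h i x" "j - N x"] by (simp add: g_def)
  qed
  have inW: "x \<in> W k" if "\<omega> k x \<noteq> 0" for k x
    using eventually_nhds_x_imp_x[OF W(2)[of x k]] that by blast
  have offW: "\<omega> k x = 0 \<and> \<omega>' k x = 0" if "x \<notin> W k" for k x
    using inW that C1_deriv_locally_zero[OF \<omega>(1) W(2)[OF that]] by blast
  have local: "\<exists>j U. open U \<and> x \<in> U \<and> (\<forall>p\<in>U. \<omega> j p = 1)" for x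
    using cover[of x] by (auto simp: eventually_nhds)
  have der_g: "(g has_derivative blinfun_apply (?G' j x)) (at x)"
    if U: "open U" "x \<in> U" and one: "\<And>p. p \<in> U \<Longrightarrow> \<omega> j p = 1" for j U x
  proof (rule has_derivative_transform_within_open[OF _ U])
    have xW: "x \<in> W (0 + j)" using inW[of j x] one[OF U(2)] by simp
    show "(?G j has_derivative blinfun_apply (?G' j x)) (at x)"
      by (intro glue_has_derivative(1)[where W = W] \<omega>(1) W h h'(1) xW)
    show "?G j p = g p" if "p \<in> U" for p using g_eq[OF one[OF that]] by simp
  qed
  have "\<forall>x. \<exists>T. (g has_derivative blinfun_apply T) (at x)"
    using local der_g by metis
  then obtain g' where g': "\<And>x. (g has_derivative blinfun_apply (g' x)) (at x)" by metis
  have g'_eq: "g' x = ?G' j x"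
    if "open U" "x \<in> U" "\<And>p. p \<in> U \<Longrightarrow> \<omega> j p = 1" for j U x
    using has_derivative_unique[OF g' der_g[OF that]] by (simp add: blinfun_apply_inject)
  have "isCont g' x" for x
  proof -
    obtain j U where U: "open U" "x \<in> U" "\<And>p. p \<in> U \<Longrightarrow> \<omega> j p = 1" using local by metis
    have xW: "x \<in> W (0 + j)" using inW[of j x] U by simp
    have "isCont (?G' j) x" by (intro glue_has_derivative(2)[where W = W] \<omega>(1) W h h'(1) xW)
    moreover have "\<forall>\<^sub>F p in nhds x. g' p = ?G' j p"
      unfolding eventually_nhds using U g'_eq[OF U(1) _ U(3)] by blast
    ultimately show ?thesis using isCont_cong by blast
  qed
  then have C1: "C1_deriv g g'"
    using g' by (simp add: C1_deriv_def continuous_on_eq_continuous_at)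
  \<comment> \<open>The distance to \<open>A\<close> need not be attained, hence the factor two.\<close>
  have proj: "\<exists>a\<in>A. dist x a \<le> 2 * infdist x A \<and> (x \<in> A \<longrightarrow> a = x)" for x
  proof (cases "x \<in> A")
    case False
    then have "infdist x A > 0"
      using A infdist_pos_not_in_closed by metis
    then have "(INF a\<in>A. dist x a) < 2 * infdist x A" using A(2) by (simp add: infdist_def)
    then obtain a where "a \<in> A" "dist x a < 2 * infdist x A"
      using cINF_less_iff[OF A(2) bdd_below_image_dist] by blast
    then show ?thesis using False by force
  qed auto
  have t': "t i * norm (\<omega>' i x) \<le> s * (1/2) ^ i" for i x
    using order_trans[OF mult_left_mono[OF B t(2)] t(3)] .
  have g'_bound: "norm (g' x - Q) \<le> K' + (\<Sum>i\<in>{0..<j}. 2 * ((t i + 2 * K * infdist x A) * norm (\<omega>' i x)))"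
    if Q: "\<And>i. x \<in> W i \<Longrightarrow> norm (h' i x - Q) \<le> K'"
      and U: "open U" "x \<in> U" "\<And>p. p \<in> U \<Longrightarrow> \<omega> j p = 1" for Q K' x j U
  proof -
    obtain a where a: "a \<in> A" "dist x a \<le> 2 * infdist x A" using proj by blast
    have nn: "0 \<le> K * infdist x A" using pos by (simp add: infdist_nonneg)
    have "norm (?G' j x - Q) \<le> K' + (\<Sum>i\<in>{0..<0 + j}. 2 * ((t i + 2 * K * infdist x A) * norm (\<omega>' i x)))"
    proof (rule norm_glue'_diff_le[where W = W and c = "f a"])
      show "\<omega> (0 + j) x = 1" using U by simp
      show "antimono (\<lambda>i. t i + 2 * K * infdist x A)" using t(1) by (simp add: antimono_def)
      show "0 \<le> t i + 2 * K * infdist x A" for i using t(2)[of i] nn by simp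
    qed (use \<omega>(2) offW Q near[OF _ a] in auto)
    then show ?thesis using g'_eq[OF U] by simp
  qed
  show ?thesis
  proof (rule that[OF C1])
    fix x
    obtain j U where U: "open U" "x \<in> U" "\<And>p. p \<in> U \<Longrightarrow> \<omega> j p = 1" using local by metis
    have "norm (g' x - 0) \<le> K + (\<Sum>i\<in>{0..<j}. 2 * ((t i + 2 * K * infdist x A) * norm (\<omega>' i x)))"
      using h'(2) by (intro g'_bound[OF _ U]) simp
    also have "(\<Sum>i\<in>{0..<j}. 2 * ((t i + 2 * K * infdist x A) * norm (\<omega>' i x))) \<le> (\<Sum>i\<in>{0..<j}. 6 * s * (1/2) ^ i)"
    proof (rule sum_mono)
      fix i
      have "K * (norm (\<omega>' i x) * infdist x A) \<le> K * \<eta> i" using \<eta> pos by (intro mult_left_mono) auto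
      then have "K * (norm (\<omega>' i x) * infdist x A) \<le> s * (1/2) ^ i" using \<eta>K[of i] by (simp add: mult.commute)
      then show "2 * ((t i + 2 * K * infdist x A) * norm (\<omega>' i x)) \<le> 6 * s * (1/2) ^ i"
        using t'[of i x] by (simp add: algebra_simps)
    qed
    also have "\<dots> \<le> 2 * (6 * s)" using pos by (intro sum_half_powers_le) simp
    finally show "norm (g' x) \<le> K + 12 * s" by simp
  next
    fix x assume x: "x \<in> A"
    obtain j U where U: "open U" "x \<in> U" "\<And>p. p \<in> U \<Longrightarrow> \<omega> j p = 1" using local by metis
    have "norm (g' x - D x) \<le> \<beta> + (\<Sum>i\<in>{0..<j}. 2 * ((t i + 2 * K * infdist x A) * norm (\<omega>' i x)))"
      using on_A(1)[OF x] by (intro g'_bound[OF _ U])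
    also have "(\<Sum>i\<in>{0..<j}. 2 * ((t i + 2 * K * infdist x A) * norm (\<omega>' i x))) \<le> (\<Sum>i\<in>{0..<j}. 2 * s * (1/2) ^ i)"
      using t' x by (intro sum_mono) simp
    also have "\<dots> \<le> 2 * (2 * s)" using pos by (intro sum_half_powers_le) simp
    finally show "norm (g' x - D x) \<le> \<beta> + 4 * s" by simp
  next
    show "(\<beta> + 4 * s)-lipschitz_on A (\<lambda>x. f x - g x)"
    proof (rule lipschitz_onI)
      fix z w assume z: "z \<in> A" and w: "w \<in> A"
      obtain j1 j2 where j: "\<omega> j1 z = 1" "\<omega> j2 w = 1" using local by metis
      define j where "j = max j1 j2"
      have ev: "f x - g x = glue (\<lambda>i. \<omega> i x) (\<lambda>i. f x - h i x) j 0" if "\<omega> i x = 1" "i \<le> j" for i x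
      proof -
        have "?G j x = ?G i x"
          using glue_stable[of "\<lambda>i. \<omega> i x" 0 i "\<lambda>i. h i x" "j - i"] that by simp
        then show ?thesis using g_eq[OF that(1)] by (simp add: glue_const_diff)
      qed
      have err: "norm (f x - h i x) \<le> t i" if "x \<in> A" "0 < \<omega> i x" for i x
        using near[of x i x] inW[of i x] that by (simp add: norm_minus_commute)
      have "norm (glue (\<lambda>i. \<omega> i z) (\<lambda>i. f z - h i z) j 0 - glue (\<lambda>i. \<omega> i w) (\<lambda>i. f w - h i w) j 0)
        \<le> (\<beta> + (\<Sum>i\<in>{0..<0 + j}. 2 * (t i * B i))) * norm (z - w)"
      proof (rule norm_glue_diff_le)
        show "\<exists>i\<in>{0..0 + j}. \<omega> i z = 1" "\<exists>i\<in>{0..0 + j}. \<omega> i w = 1" using j by (auto simp: j_def)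
        show "\<bar>\<omega> i z - \<omega> i w\<bar> \<le> B i * norm (z - w)" for i
        proof -
          have "(B i)-lipschitz_on UNIV (\<omega> i)"
            using C1_derivD(1)[OF \<omega>(1)] B order_trans[OF norm_ge_zero B]
            by (intro lipschitz_on_of_derivative) auto
          from lipschitz_onD[OF this, of z w] show ?thesis by (simp add: dist_norm)
        qed
        show "norm (f z - h i z - (f w - h i w)) \<le> \<beta> * norm (z - w)" if "0 < \<omega> i z" "0 < \<omega> i w" for i
          using that inW[of i z] inW[of i w] z w by (intro on_A(2)) auto
      qed (use \<omega>(2) err z w t pos in auto)
      moreover have "(\<Sum>i\<in>{0..<0 + j}. 2 * (t i * B i)) \<le> 4 * s"
      proof -
        have "(\<Sum>i\<in>{0..<0 + j}. 2 * (t i * B i)) \<le> (\<Sum>i\<in>{0..<j}. 2 * s * (1/2) ^ i)"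
          unfolding add_0 using t(3) by (intro sum_mono) simp
        also have "\<dots> \<le> 2 * (2 * s)" using pos by (intro sum_half_powers_le) simp
        finally show ?thesis by simp
      qed
      then have "(\<beta> + (\<Sum>i\<in>{0..<0 + j}. 2 * (t i * B i))) * norm (z - w) \<le> (\<beta> + 4 * s) * norm (z - w)"
        by (intro mult_right_mono) auto
      ultimately show "dist (f z - g z) (f w - g w) \<le> (\<beta> + 4 * s) * dist z w"
        using ev[OF j(1)] ev[OF j(2)] by (simp add: dist_norm j_def)
    qed (use pos in simp)
  qed
qed

section \<open>Approximation together with the derivative\<close>

lemma patchwork_radii:
  assumes mvc: "mean_value_condition A f D" and e: "e > 0"
  obtains r where "\<And>y. y \<in> A \<Longrightarrow> r y > 0"
    "\<And>y a. y \<in> A \<Longrightarrow> a \<in> A \<inter> ball y (r y) \<Longrightarrow> norm (D a - D y) \<le> e"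
    "\<And>y. y \<in> A \<Longrightarrow> e-lipschitz_on (A \<inter> ball y (r y)) (\<lambda>x. f x - D y x)"
proof -
  have "\<exists>r>0. (\<forall>a\<in>A \<inter> ball y r. norm (D a - D y) \<le> e) \<and> e-lipschitz_on (A \<inter> ball y r) (\<lambda>x. f x - D y x)"
    if y: "y \<in> A" for y
  proof -
    obtain r1 where r1: "r1 > 0" "\<And>z w. z \<in> A \<inter> ball y r1 \<Longrightarrow> w \<in> A \<inter> ball y r1 \<Longrightarrow>
        norm (f z - f w - D y (z - w)) \<le> e * norm (z - w)"
      using mvc e y unfolding mean_value_condition_def by blast
    have "continuous_on A D" using mvc by (simp add: mean_value_condition_def)
    then obtain r2 where r2: "r2 > 0" "\<And>a. a \<in> A \<Longrightarrow> dist a y < r2 \<Longrightarrow> dist (D a) (D y) < e"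
      using y e unfolding continuous_on_iff by meson
    have "e-lipschitz_on (A \<inter> ball y (min r1 r2)) (\<lambda>x. f x - D y x)"
    proof (rule lipschitz_onI)
      fix z w assume "z \<in> A \<inter> ball y (min r1 r2)" "w \<in> A \<inter> ball y (min r1 r2)"
      then show "dist (f z - D y z) (f w - D y w) \<le> e * dist z w"
        using r1(2)[of z w] by (simp add: dist_norm blinfun.diff_right algebra_simps)
    qed (use e in simp)
    moreover have "norm (D a - D y) \<le> e" if "a \<in> A \<inter> ball y (min r1 r2)" for a
      using r2(2)[of a] that by (simp add: dist_norm[symmetric] dist_commute)
    ultimately show ?thesis using r1(1) r2(1) by (intro exI[of _ "min r1 r2"]) auto
  qed
  then show ?thesis using that by metis
qed

text \<open>
  Dividing by one plus the partial sums of \<open>B\<close>, rather than by \<open>1 + B k\<close>, makes the tolerances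
  decreasing.
\<close>

lemma antimono_tolerance:
  fixes B :: "nat \<Rightarrow> real"
  assumes e: "e > 0" and B: "\<And>k. 0 \<le> B k"
  obtains t where "antimono t" "\<And>k. 0 < t k" "\<And>k. t k \<le> e * (1/2) ^ k / 8" "\<And>k. t k * B k \<le> e * (1/2) ^ k"
proof -
  define c where "c k = (\<Sum>j\<le>k. B j)" for k
  define t where "t k = (e * (1/2) ^ k / 8) / (1 + c k)" for k
  have c0: "0 \<le> c k" for k using B by (simp add: c_def sum_nonneg)
  have cB: "B k \<le> c k" for k using B by (auto simp: c_def intro: member_le_sum)
  have up: "t k \<le> e * (1/2) ^ k / 8" for k
    using c0[of k] e by (simp add: t_def divide_le_eq mult_le_cancel_left1)
  show ?thesis
  proof
    show "0 < t k" for k using e c0[of k] by (simp add: t_def add_pos_nonneg)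
    show "t k * B k \<le> e * (1/2) ^ k" for k
    proof -
      have "t k * B k \<le> t k * (1 + c k)"
        using cB[of k] e c0[of k] by (intro mult_left_mono) (simp_all add: t_def)
      also have "\<dots> = e * (1/2) ^ k / 8"
      proof -
        have "1 + c k \<noteq> 0" using c0[of k] by linarith
        then show ?thesis unfolding t_def by (rule nonzero_divide_eq_eq[THEN iffD1, OF _ refl, symmetric])
      qed
      also have "\<dots> \<le> e * (1/2) ^ k" using e by simp
      finally show ?thesis .
    qed
    show "antimono t"
    proof (rule decseq_SucI)
      fix k show "t (Suc k) \<le> t k"
        unfolding t_def using e c0[of k] B[of "Suc k"]
        by (intro frac_le) (auto simp: c_def add_pos_nonneg)
    qed
  qed (rule up)
qed

text \<open>
  Approximation of \<open>f\<close> on \<open>A\<close> together with its prospective derivative. Near \<open>y \<in> A\<close> the mapping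
  \<open>f - D y\<close> is \<open>e\<close>-Lipschitz on \<open>A\<close>, so property (*) provides a correction with small derivative
  that turns \<open>D y\<close> into a \<open>C\<^sup>1\<close> mapping close to \<open>f\<close>. These patches have index \<open>2 n\<close> and are
  glued on the level \<open>n\<close> of the decomposition of \<open>A\<close>. Away from \<open>A\<close> one uses \<open>C\<^sup>1\<close> approximants of
  \<open>f\<close> itself. A single one would not do, because the cutoffs near \<open>A\<close> have unbounded slopes and
  require arbitrarily small errors; therefore there is one for each odd index \<open>2 n + 1\<close>, used
  where the distance to \<open>A\<close> exceeds a scale that shrinks with \<open>n\<close>.
\<close>

lemma smooth_approximation:
  fixes A :: "'x::banach set" and f :: "'x \<Rightarrow> 'z::banach" and z :: 'z
  assumes star: "property_star_const TYPE('x) TYPE('z) C" and z: "z \<noteq> 0"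
    and A: "closed A" "A \<noteq> {}" and f: "L-lipschitz_on A f" and mvc: "mean_value_condition A f D"
    and M: "\<And>y. y \<in> A \<Longrightarrow> norm (D y) \<le> M" and \<epsilon>: "\<epsilon> > 0"
  obtains g g' where "C1_deriv g g'" "\<And>x. norm (g' x) \<le> max M (C * L) + \<epsilon>"
    "\<And>a. a \<in> A \<Longrightarrow> norm (g' a - D a) \<le> \<epsilon>" "\<epsilon>-lipschitz_on A (\<lambda>x. f x - g x)"
proof -
  have C: "C \<ge> 1" using star by (simp add: property_star_const_def)
  have L: "L \<ge> 0" using f by (rule lipschitz_on_nonneg)
  have M0: "M \<ge> 0" using A(2) M norm_ge_zero order_trans by blast
  \<comment> \<open>Chosen so that \<open>K + 12 e = max M (C L) + \<epsilon>\<close> for the constant \<open>K\<close> below, which bounds all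
      glued derivatives.\<close>
  define e where "e = \<epsilon> / (C + 12)"
  have e: "e > 0" using \<epsilon> C by (simp add: e_def)
  have "(C + 12) * e = \<epsilon>" using C by (simp add: e_def)
  then have e\<epsilon>: "C * e + 12 * e = \<epsilon>" by (simp add: algebra_simps)
  define K where "K = max M (C * L) + C * e"
  have "0 < C * e" using C e by simp
  then have K: "M + C * e \<le> K" "C * L \<le> K" "0 \<le> K" using M0 unfolding K_def by linarith+
  define \<beta> where "\<beta> = (1 + C) * e"
  have \<beta>: "0 \<le> \<beta>" using C e by (simp add: \<beta>_def)

  obtain r where r: "\<And>y. y \<in> A \<Longrightarrow> r y > 0"
    "\<And>y a. y \<in> A \<Longrightarrow> a \<in> A \<inter> ball y (r y) \<Longrightarrow> norm (D a - D y) \<le> e"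
    "\<And>y. y \<in> A \<Longrightarrow> e-lipschitz_on (A \<inter> ball y (r y)) (\<lambda>x. f x - D y x)"
    using patchwork_radii[OF mvc e] by blast
  obtain S :: "nat \<Rightarrow> 'x \<Rightarrow> 'x set" where S: "\<And>n y. S n y \<subseteq> A" "\<And>n y. S n y \<noteq> {} \<Longrightarrow> y \<in> A"
    "\<And>x. x \<in> A \<Longrightarrow> \<exists>n y. x \<in> S n y"
    "\<And>n x x' y y'. x \<in> S n y \<Longrightarrow> x' \<in> S n y' \<Longrightarrow> y \<noteq> y' \<Longrightarrow> (1/2) ^ Suc n \<le> dist x x'"
    "\<And>n x y p. x \<in> S n y \<Longrightarrow> dist x p < (1/2) ^ n \<Longrightarrow> p \<in> ball y (r y)"
    using sigma_discrete_decomposition[of A r] r(1) by blast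

  \<comment> \<open>An eighth of \<open>(1/2)^n\<close>: neighbourhoods of radius \<open>\<rho> n\<close> of the sets of level \<open>n\<close> stay apart by
      \<open>2 \<rho> n\<close>, and their points have nearly closest points of \<open>A\<close> in the ball of the same centre.\<close>
  define \<rho> :: "nat \<Rightarrow> real" where "\<rho> n = (1/2) ^ n / 8" for n
  have \<rho>: "0 < \<rho> n" "8 * \<rho> n = (1/2) ^ n" for n by (simp_all add: \<rho>_def)
  define WE where "WE n = {x. \<exists>y. \<exists>s\<in>S n y. dist x s < \<rho> n}" for n
  define cen where "cen n x = (SOME y. \<exists>s\<in>S n y. dist x s < \<rho> n)" for n x
  have cen: "\<exists>s\<in>S n (cen n x). dist x s < \<rho> n" if "x \<in> WE n" for n x
    unfolding cen_def by (rule someI_ex) (use that in \<open>simp add: WE_def\<close>)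
  have cenA: "cen n x \<in> A" if "x \<in> WE n" for n x using cen[OF that] S(2) by blast
  have sep: "(1/2) ^ Suc n - 2 * \<rho> n \<le> dist x p"
    if "s \<in> S n y" "dist x s < \<rho> n" "s' \<in> S n y'" "dist p s' < \<rho> n" "y \<noteq> y'" for n x p s s' y y'
    using S(4)[OF that(1,3,5)] that(2,4) dist_triangle[of s s' x] dist_triangle[of x s' p]
      dist_commute[of s x] by linarith
  have cen_eq: "cen n x = y" if "s \<in> S n y" "dist x s < \<rho> n" for n x s y
  proof (rule ccontr)
    assume ne: "cen n x \<noteq> y"
    have "x \<in> WE n" using that by (auto simp: WE_def)
    then obtain s' where "s' \<in> S n (cen n x)" "dist x s' < \<rho> n" using cen by blast
    from sep[OF this that ne] show False using \<rho>[of n] by simp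
  qed

  \<comment> \<open>Even indices cut off around a level of the decomposition, odd indices around all of \<open>A\<close>.\<close>
  define SS where "SS k = (if even k then (\<Union>y. S (k div 2) y) else A)" for k
  define R where "R k = (if even k then \<rho> (k div 2) / 2 else (1/2) ^ (k div 2))" for k
  define \<eta> where "\<eta> k = e * (1/2) ^ k / (1 + K)" for k :: nat
  have R: "R k > 0" for k using \<rho> by (simp add: R_def)
  have \<eta>: "\<eta> k > 0" for k using e K by (simp add: \<eta>_def)
  have SSA: "SS k \<subseteq> A" for k using S(1) by (auto simp: SS_def)
  define cut where "cut k \<phi> \<phi>' \<rho>' B \<longleftrightarrow> 0 < \<rho>' \<and> C1_deriv \<phi> \<phi>' \<and> (\<forall>x. 0 \<le> \<phi> x \<and> \<phi> x \<le> (1::real)) \<and>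
    (\<forall>s\<in>SS k. \<forall>x. dist x s < \<rho>' \<longrightarrow> \<phi> x = 1) \<and> (\<forall>x. \<phi> x \<noteq> 0 \<longrightarrow> (\<exists>s\<in>SS k. dist x s < R k)) \<and>
    (\<forall>x. norm (\<phi>' x) \<le> B) \<and> (\<forall>x. norm (\<phi>' x) * infdist x A \<le> \<eta> k)"
    for k \<phi> \<phi>' and \<rho>' B :: real
  have "\<forall>k. \<exists>\<phi> \<phi>' \<rho>' B. cut k \<phi> \<phi>' \<rho>' B"
  proof
    fix k
    show "\<exists>\<phi> \<phi>' \<rho>' B. cut k \<phi> \<phi>' \<rho>' B"
    proof (rule logarithmic_cutoff[OF star z SSA[of k] R[of k] \<eta>[of k]])
      fix \<phi> :: "'x \<Rightarrow> real" and \<phi>' \<rho>' B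
      assume "0 < \<rho>'" "C1_deriv \<phi> \<phi>'" "\<And>x. 0 \<le> \<phi> x \<and> \<phi> x \<le> 1"
        "\<And>x s. s \<in> SS k \<Longrightarrow> dist x s < \<rho>' \<Longrightarrow> \<phi> x = 1" "\<And>x. \<phi> x \<noteq> 0 \<Longrightarrow> \<exists>s\<in>SS k. dist x s < R k"
        "\<And>x. norm (\<phi>' x) \<le> B" "\<And>x. norm (\<phi>' x) * infdist x A \<le> \<eta> k"
      then have "cut k \<phi> \<phi>' \<rho>' B" unfolding cut_def by simp
      then show ?thesis by (intro exI)
    qed
  qed
  then obtain \<phi> \<phi>' \<rho>' B where "\<And>k. cut k (\<phi> k) (\<phi>' k) (\<rho>' k) (B k)" by metis
  then have \<phi>: "\<And>k. 0 < \<rho>' k" "\<And>k. C1_deriv (\<phi> k) (\<phi>' k)" "\<And>k x. 0 \<le> \<phi> k x \<and> \<phi> k x \<le> 1"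
    "\<And>k s x. s \<in> SS k \<Longrightarrow> dist x s < \<rho>' k \<Longrightarrow> \<phi> k x = 1"
    "\<And>k x. \<phi> k x \<noteq> 0 \<Longrightarrow> \<exists>s\<in>SS k. dist x s < R k"
    "\<And>k x. norm (\<phi>' k x) \<le> B k" "\<And>k x. norm (\<phi>' k x) * infdist x A \<le> \<eta> k"
    unfolding cut_def by blast+
  have B0: "0 \<le> B k" for k using order_trans[OF norm_ge_zero \<phi>(6)] .
  obtain t where t: "antimono t" "\<And>k. 0 < t k" "\<And>k. t k \<le> e * (1/2) ^ k / 8" "\<And>k. t k * B k \<le> e * (1/2) ^ k"
    by (rule antimono_tolerance[where B = B, OF e B0]) (rule that)

  define patch where "patch k y H H' \<longleftrightarrow> C1_deriv H H' \<and> (\<forall>x. norm (H' x - D y) \<le> C * e) \<and>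
      (\<forall>a\<in>A \<inter> ball y (r y). norm (f a - H a) \<le> t k)" for k :: nat and y H H'
  have "\<forall>k y. \<exists>H H'. y \<in> A \<longrightarrow> patch k y H H'"
  proof (intro allI)
    fix k y
    show "\<exists>H H'. y \<in> A \<longrightarrow> patch k y H H'"
    proof (cases "y \<in> A")
      case True
      obtain d d' where d: "C1_deriv d d'" "\<And>x. norm (d' x) \<le> C * e"
        "\<And>x. x \<in> A \<inter> ball y (r y) \<Longrightarrow> norm (f x - D y x - d x) < t k"
        by (rule star_approximation[OF star r(3)[OF True] t(2)[of k]]) (rule that)
      have "patch k y (\<lambda>x. D y x + d x) (\<lambda>x. D y + d' x)"
        unfolding patch_def using C1_deriv_add[OF C1_deriv_blinfun d(1)] d(2) d(3)
        by (auto simp: algebra_simps less_imp_le)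
      then show ?thesis by blast
    qed blast
  qed
  then obtain H H' where "\<And>k y. y \<in> A \<Longrightarrow> patch k y (H k y) (H' k y)" by metis
  then have H: "\<And>k y. y \<in> A \<Longrightarrow> C1_deriv (H k y) (H' k y)"
    "\<And>k y x. y \<in> A \<Longrightarrow> norm (H' k y x - D y) \<le> C * e"
    "\<And>k y a. y \<in> A \<Longrightarrow> a \<in> A \<Longrightarrow> a \<in> ball y (r y) \<Longrightarrow> norm (f a - H k y a) \<le> t k"
    unfolding patch_def by blast+
  have "\<forall>k. \<exists>V V'. C1_deriv V V' \<and> (\<forall>x. norm (V' x) \<le> C * L) \<and> (\<forall>a\<in>A. norm (f a - V a) < t k)"
  proof
    fix k
    show "\<exists>V V'. C1_deriv V V' \<and> (\<forall>x. norm (V' x) \<le> C * L) \<and> (\<forall>a\<in>A. norm (f a - V a) < t k)"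
    proof (rule star_approximation[OF star f t(2)[of k]])
      fix V V'
      assume "C1_deriv V V'" "\<And>x. norm (V' x) \<le> C * L" "\<And>a. a \<in> A \<Longrightarrow> norm (f a - V a) < t k"
      then show ?thesis by (intro exI conjI allI ballI)
    qed
  qed
  then obtain V V' where V: "\<And>k. C1_deriv (V k) (V' k)" "\<And>k x. norm (V' k x) \<le> C * L"
      "\<And>k a. a \<in> A \<Longrightarrow> norm (f a - V k a) < t k"
    by metis

  have H'K: "norm (H' k y x) \<le> M + C * e" if "y \<in> A" for k y x
    using norm_triangle_sub[of "H' k y x" "D y"] H(2)[OF that, of k x] M[OF that] by linarith
  have near_of: "norm (u x - f a) \<le> t k + K * dist x a"
    if "C1_deriv u u'" "\<And>x. norm (u' x) \<le> K" "norm (f a - u a) \<le> t k" for u u' x a k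
  proof -
    have "K-lipschitz_on UNIV u"
      using that(2) K(3) C1_derivD(1)[OF that(1)] by (intro lipschitz_on_of_derivative) auto
    then have "norm (u x - u a) \<le> K * dist x a" using lipschitz_onD[of K UNIV u x a] by (simp add: dist_norm)
    moreover have "norm (u x - f a) \<le> norm (u x - u a) + norm (f a - u a)"
      using norm_triangle_ineq4[of "u x - u a" "f a - u a"] by simp
    ultimately show ?thesis using that(3) by linarith
  qed

  \<comment> \<open>For odd \<open>k\<close> the complementary cutoff is the weight: it vanishes near \<open>A\<close> and is one away from \<open>A\<close>.\<close>
  define \<omega> where "\<omega> k x = (if even k then \<phi> k x else 1 - \<phi> k x)" for k x
  define \<omega>' where "\<omega>' k x = (if even k then \<phi>' k x else 0 - \<phi>' k x)" for k x
  define W where "W k = (if even k then WE (k div 2) else - A)" for k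
  define h where "h k x = (if even k then H k (cen (k div 2) x) x else V k x)" for k x
  define h' where "h' k x = (if even k then H' k (cen (k div 2) x) x else V' k x)" for k x
  have even: "\<omega> k = \<phi> k" "W k = WE (k div 2)" "h k x = H k (cen (k div 2) x) x"
    "h' k x = H' k (cen (k div 2) x) x" "SS k = (\<Union>y. S (k div 2) y)" "R k = \<rho> (k div 2) / 2"
    if "even k" for k x
    using that by (simp_all add: \<omega>_def W_def h_def h'_def SS_def R_def fun_eq_iff)
  have odd: "\<omega> k = (\<lambda>x. 1 - \<phi> k x)" "W k = - A" "h k = V k" "h' k = V' k" "SS k = A" "R k = (1/2) ^ (k div 2)"
    if "odd k" for k
    using that by (simp_all add: \<omega>_def W_def h_def h'_def SS_def R_def fun_eq_iff)
  have const_cen: "\<exists>U. open U \<and> x \<in> U \<and> U \<subseteq> WE n \<and> (\<forall>p\<in>U. cen n p = cen n x)" if x: "x \<in> WE n" for n x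
  proof -
    obtain s where s: "s \<in> S n (cen n x)" "dist x s < \<rho> n" using cen[OF x] by blast
    have "p \<in> WE n \<and> cen n p = cen n x" if "p \<in> ball s (\<rho> n)" for p
    proof -
      have "dist p s < \<rho> n" using that by (simp add: dist_commute)
      then show ?thesis using s(1) cen_eq[OF s(1)] by (auto simp: WE_def)
    qed
    then have "ball s (\<rho> n) \<subseteq> WE n" "\<forall>p\<in>ball s (\<rho> n). cen n p = cen n x" by blast+
    moreover have "x \<in> ball s (\<rho> n)" using s(2) by (simp add: dist_commute)
    ultimately show ?thesis by (intro exI[of _ "ball s (\<rho> n)"] conjI open_ball)
  qed
  have openW: "open (W k)" for k
  proof (cases "even k")
    case True
    have "open (WE n)" for n using const_cen by (subst open_subopen) blast
    then show ?thesis using True even(2) by simp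
  qed (use A odd in auto)
  have half: "dist x s < \<rho> n \<Longrightarrow> dist x a \<le> 2 * dist x s \<Longrightarrow> dist s a < (1/2) ^ n" for x s a n
    using dist_triangle[of s a x] dist_commute[of s x] \<rho>[of n] by linarith

  show ?thesis
  proof (rule gluing[where A = A and \<omega> = \<omega> and \<omega>' = \<omega>' and B = B and \<eta> = \<eta> and W = W and h = h and h' = h'
        and K = K and f = f and t = t and D = D and \<beta> = \<beta> and s = e])
    show "C1_deriv (\<omega> k) (\<omega>' k)" for k
      using \<phi>(2)[of k] C1_deriv_diff[OF C1_deriv_const[of 1] \<phi>(2)[of k]]
      by (cases "even k") (simp_all add: \<omega>_def[abs_def] \<omega>'_def[abs_def])
    show "0 \<le> \<omega> k x \<and> \<omega> k x \<le> 1" for k x using \<phi>(3)[of k x] by (auto simp: \<omega>_def)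
    show "norm (\<omega>' k x) \<le> B k" for k x using \<phi>(6)[of k x] by (simp add: \<omega>'_def)
    show "norm (\<omega>' k x) * infdist x A \<le> \<eta> k" for k x using \<phi>(7)[of k x] by (simp add: \<omega>'_def)
    show "open (W k)" for k by (rule openW)
    show "\<forall>\<^sub>F p in nhds x. \<omega> k p = 0" if x: "x \<notin> W k" for k x
    proof (cases "even k")
      case True
      have "\<omega> k p = 0" if p: "p \<in> ball x (\<rho> (k div 2) / 2)" for p
      proof (rule ccontr)
        assume "\<omega> k p \<noteq> 0"
        then obtain y s where s: "s \<in> S (k div 2) y" "dist p s < \<rho> (k div 2) / 2"
          using \<phi>(5)[of k p] even[OF True] by auto
        have "dist x s < \<rho> (k div 2)" using dist_triangle[of x s p] p s(2) by simp
        then show False using x s(1) even(2)[OF True] by (auto simp: WE_def)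
      qed
      then show ?thesis unfolding eventually_nhds
        using \<rho>(1)[of "k div 2"] by (intro exI[of _ "ball x (\<rho> (k div 2) / 2)"]) simp
    next
      case False
      then have "x \<in> SS k" using x odd by simp
      then have "\<omega> k p = 0" if "p \<in> ball x (\<rho>' k)" for p
        using \<phi>(4)[of x k p] that odd(1)[OF False] by (simp add: dist_commute)
      then show ?thesis unfolding eventually_nhds using \<phi>(1)[of k] by (intro exI[of _ "ball x (\<rho>' k)"]) simp
    qed
    show "\<exists>k. \<forall>\<^sub>F p in nhds x. \<omega> k p = 1" for x
    proof (cases "x \<in> A")
      case True
      then obtain n y where "x \<in> S n y" using S(3) by blast
      then have x: "x \<in> SS (2 * n)" by (auto simp: SS_def)
      have "\<omega> (2 * n) p = 1" if "p \<in> ball x (\<rho>' (2 * n))" for p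
        using \<phi>(4)[OF x, of p] that by (simp add: \<omega>_def dist_commute)
      then have "\<forall>\<^sub>F p in nhds x. \<omega> (2 * n) p = 1" unfolding eventually_nhds
        using \<phi>(1)[of "2 * n"] by (intro exI[of _ "ball x (\<rho>' (2 * n))"]) simp
      then show ?thesis ..
    next
      case False
      then have "infdist x A > 0" using A infdist_pos_not_in_closed by metis
      then obtain n where n: "(1/2 :: real) ^ n < infdist x A" using real_arch_pow_inv[of "infdist x A" "1/2"] by auto
      let ?k = "2 * n + 1"
      have "\<omega> ?k p = 1" if p: "p \<in> ball x (infdist x A - (1/2) ^ n)" for p
      proof (rule ccontr)
        assume "\<omega> ?k p \<noteq> 1"
        then obtain s where "s \<in> A" "dist p s < (1/2) ^ n"
          using \<phi>(5)[of ?k p] odd[of ?k] by auto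
        then show False using infdist_le[of s A x] dist_triangle[of x s p] p by simp
      qed
      then have "\<forall>\<^sub>F p in nhds x. \<omega> ?k p = 1" unfolding eventually_nhds
        using n by (intro exI[of _ "ball x (infdist x A - (1/2) ^ n)"]) simp
      then show ?thesis ..
    qed
    show "(h k has_derivative blinfun_apply (h' k x)) (at x)" if x: "x \<in> W k" for k x
    proof (cases "even k")
      case True
      then obtain U where U: "open U" "x \<in> U" "\<And>p. p \<in> U \<Longrightarrow> cen (k div 2) p = cen (k div 2) x"
        using const_cen[of x "k div 2"] x even(2) by blast
      have y: "cen (k div 2) x \<in> A" using cenA x even(2)[OF True] by simp
      have "H k (cen (k div 2) x) p = h k p" if "p \<in> U" for p
        unfolding even(3)[OF True] U(3)[OF that] ..
      then show ?thesis unfolding even(4)[OF True]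
        by (rule has_derivative_transform_within_open[OF C1_derivD(1)[OF H(1)[OF y, of k]] U(1,2)])
    next
      case False
      then show ?thesis using C1_derivD(1)[OF V(1)] odd by simp
    qed
    show "continuous_on (W k) (h' k)" for k
    proof (cases "even k")
      case True
      have "isCont (h' k) x" if x: "x \<in> W k" for x
      proof -
        obtain U where U: "open U" "x \<in> U" "\<And>p. p \<in> U \<Longrightarrow> cen (k div 2) p = cen (k div 2) x"
          using const_cen[of x "k div 2"] x even(2)[OF True] by blast
        have y: "cen (k div 2) x \<in> A" using cenA x even(2)[OF True] by simp
        have "h' k p = H' k (cen (k div 2) x) p" if "p \<in> U" for p
          unfolding even(4)[OF True] U(3)[OF that] ..
        then have "\<forall>\<^sub>F p in nhds x. h' k p = H' k (cen (k div 2) x) p"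
          unfolding eventually_nhds using U(1,2) by blast
        moreover have "isCont (H' k (cen (k div 2) x)) x"
          using C1_derivD(2)[OF H(1)[OF y], of UNIV] by (simp add: continuous_on_eq_continuous_at)
        ultimately show ?thesis using isCont_cong by blast
      qed
      then show ?thesis by (simp add: openW continuous_on_eq_continuous_at)
    next
      case False
      then show ?thesis using C1_derivD(2)[OF V(1)] odd by simp
    qed
    show "norm (h' k x) \<le> K" if x: "x \<in> W k" for k x
    proof (cases "even k")
      case True
      then show ?thesis using H'K[OF cenA, of x "k div 2" k x] x K(1) even[OF True] by simp
    next
      case False
      then show ?thesis using V(2)[of k x] K(2) odd by simp
    qed
    show "norm (h k x - f a) \<le> t k + 2 * K * infdist x A"
      if x: "x \<in> W k" and a: "a \<in> A" "dist x a \<le> 2 * infdist x A" for k x a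
    proof -
      have "norm (h k x - f a) \<le> t k + K * dist x a"
      proof (cases "even k")
        case True
        have xW: "x \<in> WE (k div 2)" using x even(2)[OF True] by simp
        obtain s where s: "s \<in> S (k div 2) (cen (k div 2) x)" "dist x s < \<rho> (k div 2)" using cen[OF xW] by blast
        have "dist x a \<le> 2 * dist x s" using a(2) infdist_le[of s A x] s(1) S(1) by fastforce
        then have "a \<in> ball (cen (k div 2) x) (r (cen (k div 2) x))" by (intro S(5)[OF s(1)] half[OF s(2)])
        then show ?thesis unfolding even(3)[OF True]
          using H'K[OF cenA[OF xW]] K(1) H(3)[OF cenA[OF xW] a(1)]
          by (intro near_of[OF H(1)[OF cenA[OF xW]]]) (auto intro: order_trans)
      next
        case False
        show ?thesis unfolding odd(3)[OF False]
          using V(2) K(2) V(3)[OF a(1)] by (intro near_of[OF V(1)]) (auto intro: order_trans less_imp_le)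
      qed
      moreover have "K * dist x a \<le> K * (2 * infdist x A)" using a(2) K(3) by (intro mult_left_mono)
      ultimately show ?thesis by simp
    qed
    have ball_cen: "a \<in> ball (cen n a) (r (cen n a))" if a: "a \<in> WE n" for n a
    proof -
      obtain s where s: "s \<in> S n (cen n a)" "dist a s < \<rho> n" using cen[OF a] by blast
      show ?thesis by (rule S(5)[OF s(1)], rule half[OF s(2)]) simp
    qed
    show "norm (h' k a - D a) \<le> \<beta>" if a: "a \<in> A" "a \<in> W k" for k a
    proof -
      have k: "even k" using a odd(2) by (cases "even k") auto
      let ?y = "cen (k div 2) a"
      have aW: "a \<in> WE (k div 2)" using a even(2)[OF k] by simp
      have "norm (D a - D ?y) \<le> e" using r(2)[OF cenA[OF aW]] a(1) ball_cen[OF aW] by blast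
      moreover have "norm (h' k a - D ?y) \<le> C * e" using H(2)[OF cenA[OF aW]] even(4)[OF k] by simp
      moreover have "norm (h' k a - D a) \<le> norm (h' k a - D ?y) + norm (D a - D ?y)"
        using norm_triangle_ineq4[of "h' k a - D ?y" "D a - D ?y"] by simp
      ultimately show ?thesis by (simp add: \<beta>_def algebra_simps)
    qed
    show "norm ((f u - h k u) - (f w - h k w)) \<le> \<beta> * norm (u - w)"
      if u: "u \<in> A" "u \<in> W k" and w: "w \<in> A" "w \<in> W k" for k u w
    proof -
      have k: "even k" using u odd(2) by (cases "even k") auto
      define n where "n = k div 2"
      have uW: "u \<in> WE n" and wW: "w \<in> WE n" using u w even(2)[OF k] by (simp_all add: n_def)
      have hk: "h k x = H k (cen n x) x" for x using even(3)[OF k] by (simp add: n_def)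
      show ?thesis
      proof (cases "cen n u = cen n w")
        case True
        define y where "y = cen n u"
        have y: "y \<in> A" "u \<in> A \<inter> ball y (r y)" "w \<in> A \<inter> ball y (r y)"
          using cenA[OF uW] ball_cen[OF uW] ball_cen[OF wW] True u w by (auto simp: y_def)
        have "C1_deriv (\<lambda>x. H k y x - D y x) (\<lambda>x. H' k y x - D y)"
          by (intro C1_deriv_diff H(1) y(1) C1_deriv_blinfun)
        then have Hlip: "(C * e)-lipschitz_on UNIV (\<lambda>x. H k y x - D y x)"
          using H(2)[OF y(1)] C e by (intro lipschitz_on_of_derivative[OF convex_UNIV C1_derivD(1)]) auto
        have n1: "norm ((H k y u - D y u) - (H k y w - D y w)) \<le> C * e * norm (u - w)"
          using lipschitz_onD[OF Hlip, of u w] by (simp add: dist_norm)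
        have n2: "norm ((f u - D y u) - (f w - D y w)) \<le> e * norm (u - w)"
          using lipschitz_onD[OF r(3)[OF y(1)] y(2,3)] by (simp add: dist_norm)
        have eq: "(f u - h k u) - (f w - h k w) =
            ((f u - D y u) - (f w - D y w)) - ((H k y u - D y u) - (H k y w - D y w))"
          using True by (simp add: hk y_def)
        have "norm ((f u - h k u) - (f w - h k w)) \<le> e * norm (u - w) + C * e * norm (u - w)"
          unfolding eq using n1 n2 norm_triangle_ineq4[of "(f u - D y u) - (f w - D y w)" "(H k y u - D y u) - (H k y w - D y w)"]
          by linarith
        then show ?thesis by (simp add: \<beta>_def distrib_right)
      next
        case False
        obtain s s' where "s \<in> S n (cen n u)" "dist u s < \<rho> n" "s' \<in> S n (cen n w)" "dist w s' < \<rho> n"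
          using cen[OF uW] cen[OF wW] by blast
        \<comment> \<open>Points that belong to different patches of one level are so far apart that the size of the
            errors is small compared with their distance.\<close>
        from sep[OF this False] have far: "2 * \<rho> n \<le> norm (u - w)" using \<rho>(2)[of n] by (simp add: dist_norm)
        have "norm (f u - h k u) \<le> t k" "norm (f w - h k w) \<le> t k"
          unfolding hk using H(3) cenA uW wW ball_cen u w by blast+
        then have "norm ((f u - h k u) - (f w - h k w)) \<le> 2 * t k"
          using norm_triangle_ineq4[of "f u - h k u" "f w - h k w"] by linarith
        also have "2 * t k \<le> e * (2 * \<rho> n)"
        proof -
          have "(1/2 :: real) ^ k \<le> (1/2) ^ n" by (rule power_decreasing) (auto simp: n_def)
          then have "e * (1/2) ^ k \<le> e * (8 * \<rho> n)" unfolding \<rho>(2) using e by (intro mult_left_mono) auto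
          then show ?thesis using t(3)[of k] by simp
        qed
        also have "\<dots> \<le> e * norm (u - w)" using far e by (intro mult_left_mono) auto
        also have "\<dots> \<le> \<beta> * norm (u - w)" using C e by (intro mult_right_mono) (auto simp: \<beta>_def algebra_simps)
        finally show ?thesis .
      qed
    qed
    show "\<eta> k * K \<le> e * (1/2) ^ k" for k
    proof -
      have "e * (1/2) ^ k * K \<le> e * (1/2) ^ k * (1 + K)" using e by (intro mult_left_mono) auto
      then show ?thesis using K(3) by (simp add: \<eta>_def divide_le_eq)
    qed
    fix g g'
    assume g: "C1_deriv g g'" "\<And>x. norm (g' x) \<le> K + 12 * e" "\<And>a. a \<in> A \<Longrightarrow> norm (g' a - D a) \<le> \<beta> + 4 * e"
      "(\<beta> + 4 * e)-lipschitz_on A (\<lambda>x. f x - g x)"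
    have le: "K + 12 * e = max M (C * L) + \<epsilon>" "\<beta> + 4 * e \<le> \<epsilon>"
      using e\<epsilon> e by (simp_all add: K_def \<beta>_def algebra_simps)
    show ?thesis
      using that[OF g(1)] g(2,3) le lipschitz_on_le[OF g(4) le(2)] by (metis order_trans)
  qed (use A t(1,4) less_imp_le[OF t(2)] K \<beta> e in auto)
qed

section \<open>Extension\<close>

text \<open>
  The mean value inequality on a ball where \<open>g'\<close> varies by at most \<open>e\<close>.
\<close>

lemma C1_deriv_mean_value_condition:
  assumes g: "C1_deriv g g'"
  shows "mean_value_condition A g g'"
  unfolding mean_value_condition_def
proof (intro conjI ballI allI impI)
  show "continuous_on A g'" using C1_derivD(2)[OF g] .
  fix y and e :: real assume "y \<in> A" and e: "e > 0"
  have "\<exists>r>0. \<forall>x. dist x y < r \<longrightarrow> dist (g' x) (g' y) < e"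
    using C1_derivD(2)[OF g, of UNIV] e unfolding continuous_on_iff by blast
  then obtain r where r: "r > 0" "\<And>x. dist x y < r \<Longrightarrow> dist (g' x) (g' y) < e" by blast
  have d: "C1_deriv (\<lambda>x. g x - g' y x) (\<lambda>x. g' x - g' y)"
    by (intro C1_deriv_diff g C1_deriv_blinfun)
  have lip: "e-lipschitz_on (ball y r) (\<lambda>x. g x - g' y x)"
    using r(2) e by (intro lipschitz_on_of_derivative[OF convex_ball C1_derivD(1)[OF d]])
      (auto simp: dist_commute[of y] dist_norm[symmetric] less_imp_le)
  have "norm (g z - g w - g' y (z - w)) \<le> e * norm (z - w)" if "z \<in> ball y r" "w \<in> ball y r" for z w
    using lipschitz_onD[OF lip that] by (simp add: dist_norm blinfun.diff_right algebra_simps)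
  then show "\<exists>r>0. \<forall>z\<in>A \<inter> ball y r. \<forall>w\<in>A \<inter> ball y r. norm (g z - g w - g' y (z - w)) \<le> e * norm (z - w)"
    using r(1) by blast
qed

lemma mean_value_condition_diff:
  assumes f: "mean_value_condition A f D" and g: "mean_value_condition A g E"
  shows "mean_value_condition A (\<lambda>x. f x - g x) (\<lambda>x. D x - E x)"
  unfolding mean_value_condition_def
proof (intro conjI ballI allI impI)
  show "continuous_on A (\<lambda>x. D x - E x)"
    using f g by (auto simp: mean_value_condition_def intro: continuous_on_diff)
  fix y and e :: real assume y: "y \<in> A" and "e > 0"
  then have e2: "e / 2 > 0" by simp
  obtain r where r: "r > 0" "\<forall>z\<in>A \<inter> ball y r. \<forall>w\<in>A \<inter> ball y r. norm (f z - f w - D y (z - w)) \<le> e / 2 * norm (z - w)"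
    using f y e2 unfolding mean_value_condition_def by blast
  obtain s where s: "s > 0" "\<forall>z\<in>A \<inter> ball y s. \<forall>w\<in>A \<inter> ball y s. norm (g z - g w - E y (z - w)) \<le> e / 2 * norm (z - w)"
    using g y e2 unfolding mean_value_condition_def by blast
  have "norm (f z - g z - (f w - g w) - (D y - E y) (z - w)) \<le> e * norm (z - w)"
    if "z \<in> A \<inter> ball y (min r s)" "w \<in> A \<inter> ball y (min r s)" for z w
  proof -
    have eq: "f z - g z - (f w - g w) - (D y - E y) (z - w) =
        (f z - f w - D y (z - w)) - (g z - g w - E y (z - w))"
      by (simp add: blinfun.diff_left)
    have "norm (f z - f w - D y (z - w)) \<le> e / 2 * norm (z - w)"
      "norm (g z - g w - E y (z - w)) \<le> e / 2 * norm (z - w)"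
      using r(2) s(2) that by auto
    then show ?thesis unfolding eq
      using norm_triangle_ineq4[of "f z - f w - D y (z - w)" "g z - g w - E y (z - w)"] by simp
  qed
  then show "\<exists>r>0. \<forall>z\<in>A \<inter> ball y r. \<forall>w\<in>A \<inter> ball y r.
      norm (f z - g z - (f w - g w) - (D y - E y) (z - w)) \<le> e * norm (z - w)"
    using r(1) s(1) by (intro exI[of _ "min r s"]) simp
qed

text \<open>
  Iterate the approximation: the error \<open>f - g\<close> has a small Lipschitz constant on \<open>A\<close> and satisfies
  the mean value condition for the small map \<open>D - g'\<close>, so it can be approximated by a mapping with
  small derivative. Only the first step contributes substantially to the derivative of the limit.
  Prescribing the value at one point \<open>a0\<close> of \<open>A\<close> makes convergence of the derivatives enough, and
  the Lipschitz constants of the errors tend to zero, so the limit agrees with \<open>f\<close> on \<open>A\<close>.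
\<close>

lemma smooth_extension:
  fixes A :: "'x::banach set" and f :: "'x \<Rightarrow> 'z::banach" and z :: 'z
  assumes star: "property_star_const TYPE('x) TYPE('z) C" and z: "z \<noteq> 0"
    and A: "closed A" "A \<noteq> {}" and f: "L-lipschitz_on A f" and mvc: "mean_value_condition A f D"
    and M: "\<And>y. y \<in> A \<Longrightarrow> norm (D y) \<le> M" and \<epsilon>: "\<epsilon> > 0"
  obtains G G' where "C1_deriv G G'" "\<And>x. norm (G' x) \<le> max M (C * L) + \<epsilon>" "\<And>a. a \<in> A \<Longrightarrow> G a = f a"
proof -
  have C: "C \<ge> 1" using star by (simp add: property_star_const_def)
  obtain a0 where a0: "a0 \<in> A" using A by blast
  \<comment> \<open>The first step costs \<open>s\<close>, the later ones together \<open>\<Sum>n. 2 C s / 2^n = 4 C s\<close>.\<close>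
  define s where "s = \<epsilon> / (5 * C)"
  have s: "s > 0" using \<epsilon> C by (simp add: s_def)
  have s\<epsilon>: "s + 4 * C * s \<le> \<epsilon>"
  proof -
    have "5 * C * s = \<epsilon>" using C by (simp add: s_def)
    moreover have "s \<le> C * s" using C s by simp
    ultimately show ?thesis by linarith
  qed
  define \<sigma> :: "nat \<Rightarrow> real" where "\<sigma> n = s * (1/2) ^ n" for n
  have \<sigma>: "\<sigma> n > 0" "\<sigma> (Suc n) = \<sigma> n / 2" "\<sigma> 0 = s" for n using s by (simp_all add: \<sigma>_def)
  have \<sigma>_lim: "(\<lambda>n. c * \<sigma> n) \<longlonglongrightarrow> 0" for c
    unfolding \<sigma>_def using tendsto_mult_right_zero[OF tendsto_mult_right_zero[OF LIMSEQ_power_zero[of "1/2 :: real"]]]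
    by simp
  define P where "P n p \<longleftrightarrow> (case p of (g, g') \<Rightarrow> C1_deriv g g' \<and> (\<forall>a\<in>A. norm (D a - g' a) \<le> \<sigma> n) \<and>
      (\<sigma> n)-lipschitz_on A (\<lambda>x. f x - g x) \<and> g a0 = f a0 \<and>
      (n = 0 \<longrightarrow> (\<forall>x. norm (g' x) \<le> max M (C * L) + s)))" for n :: nat and p
  define Q where "Q n p q \<longleftrightarrow> (\<forall>x. norm (snd q x - snd p x) \<le> 2 * C * \<sigma> n)"
    for n and p q :: "('x \<Rightarrow> 'z) \<times> ('x \<Rightarrow> 'x \<Rightarrow>\<^sub>L 'z)"

  have shift: "C1_deriv (\<lambda>x. g x + c) g'" if "C1_deriv g g'" for g :: "'x \<Rightarrow> 'z" and g' c
    using C1_deriv_add[OF that C1_deriv_const[of c]] by simp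
  have lip_shift: "l-lipschitz_on A (\<lambda>x. u x - c)" if "l-lipschitz_on A u" for l and u :: "'x \<Rightarrow> 'z" and c
    using that by (simp add: lipschitz_on_def dist_norm)
  have "\<exists>F. \<forall>n. P n (F n) \<and> Q n (F n) (F (Suc n))"
  proof (rule dependent_nat_choice)
    obtain g g' where g: "C1_deriv g g'" "\<And>x. norm (g' x) \<le> max M (C * L) + s"
      "\<And>a. a \<in> A \<Longrightarrow> norm (g' a - D a) \<le> s" "s-lipschitz_on A (\<lambda>x. f x - g x)"
      by (rule smooth_approximation[OF star z A f mvc M s]) (assumption, rule that)
    define c where "c = f a0 - g a0"
    have "P 0 (\<lambda>x. g x + c, g')"
      unfolding P_def using shift[OF g(1), of c] g(2,3) lip_shift[OF g(4), of c] \<sigma>(3)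
      by (simp add: norm_minus_commute diff_diff_eq c_def)
    then show "\<exists>p. P 0 p" ..
  next
    fix p n assume "P n p"
    then obtain g g' where p: "p = (g, g')" and g: "C1_deriv g g'" "\<And>a. a \<in> A \<Longrightarrow> norm (D a - g' a) \<le> \<sigma> n"
      "(\<sigma> n)-lipschitz_on A (\<lambda>x. f x - g x)" "g a0 = f a0"
      by (cases p) (auto simp: P_def)
    have mvc': "mean_value_condition A (\<lambda>x. f x - g x) (\<lambda>x. D x - g' x)"
      by (intro mean_value_condition_diff mvc C1_deriv_mean_value_condition g(1))
    obtain h h' where h: "C1_deriv h h'" "\<And>x. norm (h' x) \<le> max (\<sigma> n) (C * \<sigma> n) + \<sigma> (Suc n)"
      "\<And>a. a \<in> A \<Longrightarrow> norm (h' a - (D a - g' a)) \<le> \<sigma> (Suc n)"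
      "(\<sigma> (Suc n))-lipschitz_on A (\<lambda>x. (f x - g x) - h x)"
      by (rule smooth_approximation[OF star z A g(3) mvc' g(2) \<sigma>(1)[of "Suc n"]]) (assumption, rule that)
    define c where "c = - h a0"
    have "C1_deriv (\<lambda>x. g x + (h x + c)) (\<lambda>x. g' x + h' x)" by (intro C1_deriv_add g(1) shift h(1))
    moreover have "norm (D a - (g' a + h' a)) \<le> \<sigma> (Suc n)" if "a \<in> A" for a
      using h(3)[OF that] by (simp add: norm_minus_commute algebra_simps)
    moreover have "(\<sigma> (Suc n))-lipschitz_on A (\<lambda>x. f x - (g x + (h x + c)))"
      using lip_shift[OF h(4), of c] by (simp add: algebra_simps)
    ultimately have "P (Suc n) (\<lambda>x. g x + (h x + c), \<lambda>x. g' x + h' x)"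
      by (simp add: P_def c_def g(4))
    moreover have "norm (h' x) \<le> 2 * C * \<sigma> n" for x
    proof -
      have "\<sigma> n \<le> C * \<sigma> n" using C \<sigma>(1)[of n] by simp
      moreover have "2 * C * \<sigma> n = C * \<sigma> n + C * \<sigma> n" by simp
      ultimately show ?thesis using h(2)[of x] \<sigma>(1,2)[of n] by linarith
    qed
    then have "Q n p (\<lambda>x. g x + (h x + c), \<lambda>x. g' x + h' x)" by (simp add: Q_def p)
    ultimately show "\<exists>q. P (Suc n) q \<and> Q n p q" by blast
  qed
  then obtain F where F: "\<And>n. P n (F n)" "\<And>n. Q n (F n) (F (Suc n))" by blast
  define g where "g n = fst (F n)" for n
  define g' where "g' n = snd (F n)" for n
  have g: "C1_deriv (g n) (g' n)" "(\<sigma> n)-lipschitz_on A (\<lambda>x. f x - g n x)" "g n a0 = f a0" for n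
    using F(1)[of n] by (auto simp: P_def g_def g'_def split: prod.splits)
  have g0: "norm (g' 0 x) \<le> max M (C * L) + s" for x
    using F(1)[of 0] by (auto simp: P_def g'_def split: prod.splits)
  have step: "norm (g' (Suc n) x - g' n x) \<le> 2 * C * \<sigma> n" for n x
    using F(2)[of n] by (simp add: Q_def g'_def)

  \<comment> \<open>Since \<open>\<sigma> n = 2 (\<sigma> n - \<sigma> (n + 1))\<close>, the step bounds telescope.\<close>
  have tele: "norm (g' (n + k) x - g' n x) \<le> 4 * C * (\<sigma> n - \<sigma> (n + k))" for n k x
  proof (induction k)
    case (Suc k)
    have "norm (g' (n + Suc k) x - g' n x) \<le> norm (g' (Suc (n + k)) x - g' (n + k) x) + norm (g' (n + k) x - g' n x)"
      using norm_triangle_ineq[of "g' (Suc (n + k)) x - g' (n + k) x" "g' (n + k) x - g' n x"] by simp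
    also have "\<dots> \<le> 2 * C * \<sigma> (n + k) + 4 * C * (\<sigma> n - \<sigma> (n + k))"
      by (intro add_mono step Suc.IH)
    also have "\<dots> = 4 * C * (\<sigma> n - \<sigma> (n + Suc k))"
      using \<sigma>(2)[of "n + k"] by (simp add: algebra_simps)
    finally show ?case .
  qed simp
  have tail: "norm (g' m x - g' n x) \<le> 4 * C * \<sigma> n" if "n \<le> m" for m n x
  proof -
    have "0 \<le> C * \<sigma> m" using C \<sigma>(1)[of m] by simp
    then show ?thesis using tele[of n "m - n" x] that by (simp add: algebra_simps)
  qed
  have "uniformly_Cauchy_on UNIV g'"
  proof (rule uniformly_Cauchy_onI')
    fix e :: real assume "e > 0"
    then obtain N where N: "4 * C * \<sigma> N < e"
      using order_tendstoD(2)[OF \<sigma>_lim[of "4 * C"], of e] by (auto simp: eventually_sequentially)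
    have "dist (g' m x) (g' n x) < e" if "m \<ge> N" "n > m" for m n x
    proof -
      have "\<sigma> m \<le> \<sigma> N" unfolding \<sigma>_def using that s by (intro mult_left_mono power_decreasing) auto
      then have "4 * C * \<sigma> m \<le> 4 * C * \<sigma> N" using C by (intro mult_left_mono) auto
      then show ?thesis using tail[of m n x] N that by (simp add: dist_norm norm_minus_commute)
    qed
    then show "\<exists>M. \<forall>x\<in>UNIV. \<forall>m\<ge>M. \<forall>n>m. dist (g' m x) (g' n x) < e" by blast
  qed
  then obtain G' where G': "uniform_limit UNIV g' G' sequentially"
    using Cauchy_uniformly_convergent uniformly_convergent_on_def by blast
  have G'_lim: "(\<lambda>n. g' n x) \<longlonglongrightarrow> G' x" for x
    using tendsto_uniform_limitI[OF G'] by simp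
  have "\<exists>G. \<forall>x\<in>UNIV. (\<lambda>n. g n x) \<longlonglongrightarrow> G x \<and> (G has_derivative blinfun_apply (G' x)) (at x within UNIV)"
  proof (rule has_derivative_sequence)
    show "(g n has_derivative blinfun_apply (g' n x)) (at x within UNIV)" for n x
      by (rule C1_derivD(1)[OF g(1)])
    show "\<forall>\<^sub>F n in sequentially. \<forall>x\<in>UNIV. \<forall>h. norm (g' n x h - G' x h) \<le> e * norm h" if "e > 0" for e
      using uniform_limitD[OF G' that]
    proof eventually_elim
      case (elim n)
      show ?case
      proof (intro ballI allI)
        fix x h
        have "norm (g' n x - G' x) \<le> e" using elim by (simp add: dist_norm less_imp_le)
        then have "norm ((g' n x - G' x) h) \<le> e * norm h"
          using norm_blinfun[of "g' n x - G' x" h] by (meson mult_right_mono norm_ge_zero order_trans)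
        then show "norm (g' n x h - G' x h) \<le> e * norm h" by (simp add: blinfun.diff_left)
      qed
    qed
    show "(\<lambda>n. g n a0) \<longlonglongrightarrow> f a0" by (simp add: g(3))
  qed auto
  then obtain G where G: "\<And>x. (\<lambda>n. g n x) \<longlonglongrightarrow> G x" "\<And>x. (G has_derivative blinfun_apply (G' x)) (at x)"
    by auto
  show ?thesis
  proof (rule that)
    have "continuous_on UNIV G'"
      using C1_derivD(2)[OF g(1)] by (intro uniform_limit_theorem[OF _ G']) auto
    then show "C1_deriv G G'" using G(2) by (simp add: C1_deriv_def)
    show "norm (G' x) \<le> max M (C * L) + \<epsilon>" for x
    proof (rule LIMSEQ_le_const2[OF tendsto_norm[OF G'_lim]])
      have "norm (g' n x) \<le> max M (C * L) + \<epsilon>" for n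
        using norm_triangle_sub[of "g' n x" "g' 0 x"] tail[of 0 n x] g0[of x] s\<epsilon> \<sigma>(3) by simp
      then show "\<exists>N. \<forall>n\<ge>N. norm (g' n x) \<le> max M (C * L) + \<epsilon>" by blast
    qed
    show "G a = f a" if a: "a \<in> A" for a
    proof -
      have "norm (g n a - f a) \<le> dist a a0 * \<sigma> n" for n
        using lipschitz_onD[OF g(2) a a0, of n] g(3)[of n]
        by (simp add: dist_norm norm_minus_commute mult.commute)
      then have "(\<lambda>n. g n a - f a) \<longlonglongrightarrow> 0"
        by (intro Lim_null_comparison[OF _ \<sigma>_lim[of "dist a a0"]]) simp
      then have "(\<lambda>n. g n a) \<longlonglongrightarrow> f a" by (simp add: LIM_zero_iff)
      then show ?thesis using LIMSEQ_unique[OF G(1)] by blast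
    qed
  qed
qed

lemma sup_opnorm_bounds:
  assumes "bdd_above {norm (D y) | y. y \<in> A}"
  shows "0 \<le> sup_opnorm A D" "y \<in> A \<Longrightarrow> norm (D y) \<le> sup_opnorm A D"
  unfolding sup_opnorm_def using assms by (auto intro!: cSup_upper)

lemma Lip_of_C1_deriv:
  assumes g: "C1_deriv g g'" and K: "\<And>x. norm (g' x) \<le> K"
  shows "lipschitz_map UNIV g" "Lip UNIV g \<le> K"
proof -
  have "K-lipschitz_on UNIV g"
    using C1_derivD(1)[OF g] K order_trans[OF norm_ge_zero K]
    by (intro lipschitz_on_of_derivative[OF convex_UNIV]) auto
  then show "lipschitz_map UNIV g" "Lip UNIV g \<le> K" by (auto simp: lipschitz_map_def intro: Lip_le)
qed

lemma restriction_of_C1_lipschitz: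
  assumes "C1_smooth G" "lipschitz_map UNIV G" and G: "\<And>x. x \<in> A \<Longrightarrow> G x = f x"
  shows "lipschitz_map A f" "mean_value_condition_bounded A f"
proof -
  obtain L where L: "L-lipschitz_on UNIV G" using assms(2) by (auto simp: lipschitz_map_def)
  obtain G' where G': "C1_deriv G G'" using assms(1) C1_smooth_iff by blast
  have "L-lipschitz_on A f"
    using lipschitz_on_subset[OF L subset_UNIV[of A]] G by (simp add: lipschitz_on_def)
  then show "lipschitz_map A f" by (auto simp: lipschitz_map_def)
  have "mean_value_condition A f G'"
    using C1_deriv_mean_value_condition[OF G', of A] G by (simp add: mean_value_condition_def)
  moreover have "bdd_above {norm (G' y) | y. y \<in> A}"
    using norm_derivative_le_lipschitz[OF C1_derivD(1)[OF G'] L] by (intro bdd_aboveI[of _ L]) auto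
  ultimately show "mean_value_condition_bounded A f" by (auto simp: mean_value_condition_bounded_def)
qed

text \<open>
  As \<open>C \<ge> 1\<close>, the bound \<open>(1 + C) (M + L)\<close> exceeds \<open>max M (C L)\<close> by at least \<open>M + L\<close>. This is the
  tolerance granted to the extension. It vanishes only if \<open>f\<close> is constant on \<open>A\<close>, and then a
  constant extension will do, as in the case of the zero space, where no functional is available.
\<close>

lemma extension_with_Lip_bound:
  fixes A :: "'x::banach set" and f :: "'x \<Rightarrow> 'z::banach"
  assumes star: "property_star_const TYPE('x) TYPE('z) C" and A: "closed A"
    and f: "lipschitz_map A f" and mvc: "mean_value_condition A f D"
    and bdd: "bdd_above {norm (D y) | y. y \<in> A}"
  shows "\<exists>G. C1_smooth G \<and> lipschitz_map UNIV G \<and> (\<forall>x\<in>A. G x = f x) \<and>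
      Lip UNIV G \<le> (1 + C) * (sup_opnorm A D + Lip A f)"
proof -
  define M where "M = sup_opnorm A D"
  define L where "L = Lip A f"
  have C: "C \<ge> 1" using star by (simp add: property_star_const_def)
  have L: "L-lipschitz_on A f" unfolding L_def by (rule lipschitz_on_Lip[OF f])
  have pos: "0 \<le> M" "0 \<le> L"
    using sup_opnorm_bounds(1)[OF bdd] lipschitz_on_nonneg[OF L] by (simp_all add: M_def)
  have M: "norm (D y) \<le> M" if "y \<in> A" for y using sup_opnorm_bounds(2)[OF bdd that] by (simp add: M_def)
  have const: ?thesis if "\<And>x. x \<in> A \<Longrightarrow> f x = c" for c
  proof -
    note c = C1_deriv_const[of c, where 'a = 'x]
    have "Lip UNIV (\<lambda>_::'x. c) \<le> 0" "lipschitz_map UNIV (\<lambda>_::'x. c)"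
      using Lip_of_C1_deriv[OF c, of 0] by simp_all
    moreover have "0 \<le> (1 + C) * (M + L)" using C pos by simp
    ultimately show ?thesis
      using c that C1_smooth_iff by (intro exI[of _ "\<lambda>_. c"]) (auto simp: M_def L_def)
  qed
  show ?thesis
  proof (cases "A = {} \<or> M + L = 0 \<or> (\<forall>v::'z. v = 0)")
    case True
    then consider "A = {}" | a where "a \<in> A" "L = 0" | "\<forall>v::'z. v = 0" using pos by force
    then show ?thesis
    proof cases
      case 1
      then show ?thesis by (intro const[of 0]) simp
    next
      case 2
      have "f x = f a" if "x \<in> A" for x using lipschitz_onD[OF L that 2(1)] 2(2) by simp
      then show ?thesis by (rule const)
    next
      case 3
      then show ?thesis by (intro const[of 0]) simp
    qed
  next
    case False
    then obtain z :: 'z where z: "z \<noteq> 0" by blast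
    have ne: "A \<noteq> {}" and \<epsilon>: "M + L > 0" using False pos by auto
    obtain G G' where G: "C1_deriv G G'" "\<And>x. norm (G' x) \<le> max M (C * L) + (M + L)" "\<And>a. a \<in> A \<Longrightarrow> G a = f a"
      by (rule smooth_extension[OF star z A ne L mvc M \<epsilon>]) (assumption, rule that)
    have "max M (C * L) \<le> C * (M + L)"
    proof -
      have "M \<le> C * M" "0 \<le> C * L" "0 \<le> C * M" using C pos mult_right_mono[of 1 C M] by simp_all
      then show ?thesis by (simp add: distrib_left)
    qed
    then have "max M (C * L) + (M + L) \<le> (1 + C) * (M + L)" by (simp add: distrib_right)
    then show ?thesis
      using Lip_of_C1_deriv[OF G(1,2)] G(1,3) C1_smooth_iff by (auto simp: M_def L_def intro: order_trans)
  qed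
qed

theorem theorem2p2:
  fixes A :: "'x::banach set" and f :: "'x \<Rightarrow> 'z::banach"
  assumes "property_star TYPE('x) TYPE('z)"
    and "closed A"
  shows "(lipschitz_map A f \<and> mean_value_condition_bounded A f \<longleftrightarrow>
      (\<exists>G. C1_smooth G \<and> lipschitz_map UNIV G \<and> (\<forall>x\<in>A. G x = f x))) \<and>
    (\<forall>C\<^sub>0 D. property_star_const TYPE('x) TYPE('z) C\<^sub>0 \<longrightarrow> lipschitz_map A f \<longrightarrow>
      mean_value_condition A f D \<longrightarrow> bdd_above {norm (D y) | y. y \<in> A} \<longrightarrow>
      (\<exists>G. C1_smooth G \<and> lipschitz_map UNIV G \<and> (\<forall>x\<in>A. G x = f x) \<and>
        Lip UNIV G \<le> (1 + C\<^sub>0) * (sup_opnorm A D + Lip A f)))"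
proof (intro conjI iffI allI impI)
  assume "lipschitz_map A f \<and> mean_value_condition_bounded A f"
  then obtain D where D: "lipschitz_map A f" "mean_value_condition A f D" "bdd_above {norm (D y) | y. y \<in> A}"
    by (auto simp: mean_value_condition_bounded_def)
  obtain C where "property_star_const TYPE('x) TYPE('z) C"
    using assms(1) by (auto simp: property_star_def)
  from extension_with_Lip_bound[OF this assms(2) D]
  show "\<exists>G. C1_smooth G \<and> lipschitz_map UNIV G \<and> (\<forall>x\<in>A. G x = f x)" by blast
next
  assume "\<exists>G. C1_smooth G \<and> lipschitz_map UNIV G \<and> (\<forall>x\<in>A. G x = f x)"
  then obtain G where G: "C1_smooth G" "lipschitz_map UNIV G" "\<And>x. x \<in> A \<Longrightarrow> G x = f x" by blast
  show "lipschitz_map A f" "mean_value_condition_bounded A f"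
    by (rule restriction_of_C1_lipschitz[OF G], assumption)+
next
  fix C\<^sub>0 D
  assume "property_star_const TYPE('x) TYPE('z) C\<^sub>0" "lipschitz_map A f"
    "mean_value_condition A f D" "bdd_above {norm (D y) | y. y \<in> A}"
  then show "\<exists>G. C1_smooth G \<and> lipschitz_map UNIV G \<and> (\<forall>x\<in>A. G x = f x) \<and>
      Lip UNIV G \<le> (1 + C\<^sub>0) * (sup_opnorm A D + Lip A f)"
    by (intro extension_with_Lip_bound assms(2))
qed

end
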